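(* Let $p$ be a prime. The mapping $j:\mathbb{Q}_p\to T_p$ which associates to each $x\in\mathbb{Q}_p$ the element $(\{x\}_p,[x]_p)\in T_p$ is an injective homomorphism of the additive group $\mathbb{Q}_p$ into $T_p$, and for every $\alpha>0$ it is a local isometry from $(\mathbb{Q}_p,|\cdot|_p^\alpha)$ to $(T_p,\rho_\alpha)$. Furthermore, $j(\mathbb{Q})\subset j(\mathbb{Q}_p)$ is dense in $T_p$. Since $T_p$ is complete, $T_p$ is the completion of $\mathbb{Q}$ with respect to the metric $\rho_\alpha$ (i.e. the metric $(q,r)\mapsto\rho_\alpha(j(q),j(r))$ on $\mathbb{Q}$).
   Context: Each $x\in\mathbb{Q}_p$ is written uniquely as $x=\sum_{n\ge v}x_np^n$, $x_n\in\{0,\dots,p-1\}$. Its fractional part is $\{x\}_p=\sum_{n<0}x_np^n\in\mathbb{Q}\cap[0,1)$ and its integral part is $[x]_p=\sum_{n\ge0}x_np^n\in\mathbb{Z}_p$. $|\cdot|_p$ is the standard $p$-adic absolute value, and $(\mathbb{Q}_p,|\cdot|_p^\alpha)$ carries the metric $|x-y|_p^\alpha$. The $p$-adic solenoid $T_p=(\mathbb{R}\times\mathbb{Z}_p)/\{(n,-n):n\in\mathbb{Z}\}$ is realized as the set $[0,1)\times\mathbb{Z}_p$ with addition $(\xi,x)+(\eta,y)=(\xi+\eta-[\xi+\eta],\,x+y+[\xi+\eta])$, where $[\cdot]$ is the integer part of a real number, and with the metric $$\rho_\alpha(f,g)=\min(\ell_\alpha(f-g),\ell_\alpha(g-f)),\qquad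 \ell_\alpha((\xi,x))=\max(\xi,|x|_p^\alpha).$$ Local isometry means: every point has a neighborhood on which the map preserves distances. *)

theory Defs
  imports "HOL-Analysis.Analysis" "HOL-Algebra.QuotRing" "HOL-Computational_Algebra.Primes"
begin

section \<open>The field of p-adic numbers\<close>

definition padic_abs_rat :: "nat \<Rightarrow> rat \<Rightarrow> real" where
  "padic_abs_rat p q =
     (if q = 0 then 0
      else real p powi (int (multiplicity (int p) (snd (quotient_of q)))
                        - int (multiplicity (int p) (fst (quotient_of q)))))"

definition padic_Cauchy :: "nat \<Rightarrow> (nat \<Rightarrow> rat) \<Rightarrow> bool" where
  "padic_Cauchy p s \<longleftrightarrow> (\<forall>e>0. \<exists>M. \<forall>m\<ge>M. \<forall>n\<ge>M. padic_abs_rat p (s m - s n) < e)"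

definition Cauchy_ring :: "nat \<Rightarrow> (nat \<Rightarrow> rat) ring" where
  "Cauchy_ring p =
     \<lparr>carrier = {s. padic_Cauchy p s}, mult = (\<lambda>s t n. s n * t n), one = (\<lambda>_. 1),
      zero = (\<lambda>_. 0), add = (\<lambda>s t n. s n + t n)\<rparr>"

definition null_ideal :: "nat \<Rightarrow> (nat \<Rightarrow> rat) set" where
  "null_ideal p = {s. padic_Cauchy p s \<and> (\<lambda>n. padic_abs_rat p (s n)) \<longlonglongrightarrow> 0}"

text \<open>The p-adic numbers are the completion of the rationals with respect to the p-adic
  absolute value, i.e. Cauchy sequences modulo null sequences.\<close>

definition Qp :: "nat \<Rightarrow> (nat \<Rightarrow> rat) set ring" where
  "Qp p = Cauchy_ring p Quot null_ideal p"

definition Qp_of_rat :: "nat \<Rightarrow> rat \<Rightarrow> (nat \<Rightarrow> rat) set" where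
  "Qp_of_rat p q = null_ideal p +>\<^bsub>Cauchy_ring p\<^esub> (\<lambda>_. q)"

definition padic_abs :: "nat \<Rightarrow> (nat \<Rightarrow> rat) set \<Rightarrow> real" where
  "padic_abs p x = (THE r. \<forall>s\<in>x. (\<lambda>n. padic_abs_rat p (s n)) \<longlonglongrightarrow> r)"

text \<open>The locale \<^locale>\<open>Metric_space\<close> demands symmetry also outside the carrier; the value
  there is irrelevant and set to 0.\<close>

definition Qp_dist :: "nat \<Rightarrow> real \<Rightarrow> (nat \<Rightarrow> rat) set \<Rightarrow> (nat \<Rightarrow> rat) set \<Rightarrow> real" where
  "Qp_dist p \<alpha> x y =
     (if x \<in> carrier (Qp p) \<and> y \<in> carrier (Qp p)
      then padic_abs p (x \<ominus>\<^bsub>Qp p\<^esub> y) powr \<alpha> else 0)"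

definition Zp :: "nat \<Rightarrow> (nat \<Rightarrow> rat) set set" where
  "Zp p = {x \<in> carrier (Qp p). padic_abs p x \<le> 1}"


section \<open>Digit expansion, fractional part and integral part\<close>

definition Qp_tendsto :: "nat \<Rightarrow> (nat \<Rightarrow> (nat \<Rightarrow> rat) set) \<Rightarrow> (nat \<Rightarrow> rat) set \<Rightarrow> bool" where
  "Qp_tendsto p X x \<longleftrightarrow> (\<lambda>N. padic_abs p (X N \<ominus>\<^bsub>Qp p\<^esub> x)) \<longlonglongrightarrow> 0"

definition is_padic_expansion :: "nat \<Rightarrow> (nat \<Rightarrow> rat) set \<Rightarrow> (int \<Rightarrow> nat) \<Rightarrow> bool" where
  "is_padic_expansion p x a \<longleftrightarrow>
     (\<forall>n. a n < p) \<and>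
     (\<exists>v. (\<forall>n<v. a n = 0) \<and>
          Qp_tendsto p (\<lambda>N. Qp_of_rat p (\<Sum>n\<in>{v..<v + int N}. of_nat (a n) * of_nat p powi n)) x)"

definition padic_digit :: "nat \<Rightarrow> (nat \<Rightarrow> rat) set \<Rightarrow> int \<Rightarrow> nat" where
  "padic_digit p x = (THE a. is_padic_expansion p x a)"

text \<open>Only finitely many digits of negative index are nonzero; the sum is restricted to these
  because a sum over an infinite index set is 0 by convention.\<close>

definition padic_frac :: "nat \<Rightarrow> (nat \<Rightarrow> rat) set \<Rightarrow> rat" where
  "padic_frac p x =
     (\<Sum>n | n < 0 \<and> padic_digit p x n \<noteq> 0. of_nat (padic_digit p x n) * of_nat p powi n)"

definition padic_int_part :: "nat \<Rightarrow> (nat \<Rightarrow> rat) set \<Rightarrow> (nat \<Rightarrow> rat) set" where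
  "padic_int_part p x =
     (THE y. y \<in> Zp p \<and>
        Qp_tendsto p (\<lambda>N. Qp_of_rat p (\<Sum>n<N. of_nat (padic_digit p x (int n)) * of_nat p ^ n)) y)"


section \<open>The p-adic solenoid\<close>

text \<open>The group law is written multiplicatively, as required by the library's group locale.\<close>

definition Tp :: "nat \<Rightarrow> (real \<times> (nat \<Rightarrow> rat) set) monoid" where
  "Tp p =
     \<lparr>carrier = {0..<1} \<times> Zp p,
      mult = (\<lambda>(\<xi>, x) (\<eta>, y).
        (\<xi> + \<eta> - of_int \<lfloor>\<xi> + \<eta>\<rfloor>, x \<oplus>\<^bsub>Qp p\<^esub> y \<oplus>\<^bsub>Qp p\<^esub> Qp_of_rat p (of_int \<lfloor>\<xi> + \<eta>\<rfloor>))),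
      one = (0, \<zero>\<^bsub>Qp p\<^esub>)\<rparr>"

definition Tp_length :: "nat \<Rightarrow> real \<Rightarrow> real \<times> (nat \<Rightarrow> rat) set \<Rightarrow> real" where
  "Tp_length p \<alpha> = (\<lambda>(\<xi>, x). max \<xi> (padic_abs p x powr \<alpha>))"

definition Tp_dist ::
  "nat \<Rightarrow> real \<Rightarrow> real \<times> (nat \<Rightarrow> rat) set \<Rightarrow> real \<times> (nat \<Rightarrow> rat) set \<Rightarrow> real" where
  "Tp_dist p \<alpha> f g =
     min (Tp_length p \<alpha> (f \<otimes>\<^bsub>Tp p\<^esub> inv\<^bsub>Tp p\<^esub> g)) (Tp_length p \<alpha> (g \<otimes>\<^bsub>Tp p\<^esub> inv\<^bsub>Tp p\<^esub> f))"

definition solenoid_map :: "nat \<Rightarrow> (nat \<Rightarrow> rat) set \<Rightarrow> real \<times> (nat \<Rightarrow> rat) set" where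
  "solenoid_map p x = (of_rat (padic_frac p x), padic_int_part p x)"


section \<open>Local isometries and completions\<close>

definition local_isometry ::
  "'a set \<Rightarrow> ('a \<Rightarrow> 'a \<Rightarrow> real) \<Rightarrow> 'b set \<Rightarrow> ('b \<Rightarrow> 'b \<Rightarrow> real) \<Rightarrow> ('a \<Rightarrow> 'b) \<Rightarrow> bool" where
  "local_isometry M d N e f \<longleftrightarrow>
     Metric_space M d \<and> Metric_space N e \<and> f \<in> M \<rightarrow> N \<and>
     (\<forall>x\<in>M. \<exists>U. openin (Metric_space.mtopology M d) U \<and> x \<in> U \<and>
        (\<forall>y\<in>U. \<forall>z\<in>U. e (f y) (f z) = d y z))"

definition is_completion ::
  "'a set \<Rightarrow> ('a \<Rightarrow> 'a \<Rightarrow> real) \<Rightarrow> 'b set \<Rightarrow> ('b \<Rightarrow> 'b \<Rightarrow> real) \<Rightarrow> ('a \<Rightarrow> 'b) \<Rightarrow> bool" where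
  "is_completion M d N e f \<longleftrightarrow>
     Metric_space M d \<and> Metric_space N e \<and> f \<in> M \<rightarrow> N \<and>
     (\<forall>x\<in>M. \<forall>y\<in>M. e (f x) (f y) = d x y) \<and>
     Metric_space.mtopology N e closure_of (f ` M) = N \<and>
     Metric_space.mcomplete N e"

end

theory Submission
  imports Defs "HOL-Number_Theory.Cong"
begin

text \<open>The solenoid is the quotient of \<open>\<real> \<times> \<int>\<^sub>p\<close> by the integers, embedded as the pairs \<open>(n, -n)\<close>.
The proof works with arbitrary representatives \<open>(t, x)\<close> of its points (\<open>solenoid_point\<close>) instead of
the normalised ones with \<open>0 \<le> t < 1\<close>, so that carries disappear.

The arithmetic input is that every p-adic number \<open>x\<close> is a sum of some \<open>r\<close> in \<open>\<int>[1/p]\<close> and an element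
of \<open>\<int>\<^sub>p\<close>, and that \<open>\<int>[1/p]\<close> and \<open>\<int>\<^sub>p\<close> have only the integers in common. More precisely, for each
\<open>k\<close> there is exactly one truncation of \<open>x\<close>, an element of \<open>\<int>[1/p]\<close> in \<open>[0, p\<^sup>k)\<close> at p-adic distance
at most \<open>p\<^sup>-\<^sup>k\<close> from \<open>x\<close>. Differences of consecutive truncations give the digits, which proves that
expansions exist and are unique. The truncation with \<open>k = 0\<close> is the fractional part
(\<open>padic_frac_eq_truncation\<close>), and \<open>x\<close> minus it is the integral part (\<open>padic_int_part_eq\<close>).

Hence \<open>j x\<close> is the class of \<open>(r, x - r)\<close> for every admissible \<open>r\<close> (\<open>solenoid_map_eq\<close>). Admissible
choices for \<open>x\<close> and \<open>y\<close> add up to one for \<open>x + y\<close>, so \<open>j\<close> is a homomorphism. It is injective because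
\<open>x\<close> is the sum of its two parts.

The distance on the solenoid is the quotient norm of \<open>max \<bar>t\<bar> (\<bar>x\<bar>\<^sub>p powr \<alpha>)\<close>, applied to the
difference of two points (\<open>Tp_norm_point_le\<close>, \<open>Tp_norm_attained\<close>); this gives the triangle
inequality. If \<open>x - y\<close> is in \<open>\<int>\<^sub>p\<close>, then \<open>j x - j y\<close> is the class of \<open>(0, x - y)\<close>, so \<open>j\<close> preserves
distances on balls of radius 1. The images of rationals \<open>r + y\<close>, with \<open>r\<close> in \<open>\<int>[1/p]\<close> and \<open>y\<close> a
p-adically integral rational, are the classes of \<open>(r, y)\<close>. They are dense since \<open>\<int>[1/p]\<close> is dense in
\<open>\<real>\<close> and the rationals are dense in the p-adic numbers. Completeness combines compactness of
\<open>[0, 1]\<close> for the real coordinate with completeness of the p-adic numbers for the other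
(\<open>Tp_complete\<close>).\<close>

locale padic =
  fixes p :: nat
  assumes prime: "prime p"
begin

lemma prime_int: "prime (int p)" using prime by simp
lemma p_gt_1: "p > 1" using prime by (rule prime_gt_1_nat)
lemma p_pos [simp]: "p > 0" "p \<noteq> 0" using p_gt_1 by auto

section \<open>The p-adic absolute value on the rationals\<close>

lemma padic_abs_rat_0 [simp]: "padic_abs_rat p 0 = 0"
  by (simp add: padic_abs_rat_def)

text \<open>The multiplicity of p is additive, so cancelling a common factor from a fraction lowers both
multiplicities equally: the absolute value may be read off from any fraction, not only from the
reduced one.\<close>

lemma padic_abs_rat_divide_int:
  fixes a b :: int
  assumes "a \<noteq> 0" "b \<noteq> 0"
  shows "padic_abs_rat p (of_int a / of_int b) =
    real p powi (int (multiplicity (int p) b) - int (multiplicity (int p) a))"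
proof -
  obtain n d where nd: "quotient_of (of_int a / of_int b) = (n, d)" by fastforce
  have d: "d > 0" using quotient_of_denom_pos[OF nd] .
  have "(of_int a / of_int b :: rat) = of_int n / of_int d" using quotient_of_div[OF nd] .
  hence "(of_int (a * d) :: rat) = of_int (n * b)" using assms d by (simp add: field_simps)
  hence eq: "a * d = n * b" by (simp only: of_int_eq_iff)
  hence n: "n \<noteq> 0" using assms d by auto
  have pe: "prime_elem (int p)" using prime_int by simp
  have "multiplicity (int p) a + multiplicity (int p) d =
        multiplicity (int p) n + multiplicity (int p) b"
    using eq assms d n
      prime_elem_multiplicity_mult_distrib[OF pe, of a d]
      prime_elem_multiplicity_mult_distrib[OF pe, of n b] by simp
  hence "int (multiplicity (int p) d) - int (multiplicity (int p) n) =
     int (multiplicity (int p) b) - int (multiplicity (int p) a)" by linarith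
  thus ?thesis using assms by (simp add: padic_abs_rat_def nd)
qed

lemma rat_fraction_cases:
  fixes q :: rat
  assumes "q \<noteq> 0"
  obtains a b :: int where "a \<noteq> 0" "b \<noteq> 0" "q = of_int a / of_int b"
proof -
  obtain n d where nd: "quotient_of q = (n, d)" by fastforce
  have "d > 0" "q = of_int n / of_int d"
    using quotient_of_denom_pos[OF nd] quotient_of_div[OF nd] by auto
  with assms show ?thesis by (intro that[of n d]) auto
qed

lemma padic_abs_rat_pos: "q \<noteq> 0 \<Longrightarrow> padic_abs_rat p q > 0"
  by (simp add: padic_abs_rat_def)

lemma padic_abs_rat_nonneg [simp]: "padic_abs_rat p q \<ge> 0"
  by (simp add: padic_abs_rat_def)

lemma padic_abs_rat_eq_0_iff [simp]: "padic_abs_rat p q = 0 \<longleftrightarrow> q = 0"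
  using padic_abs_rat_pos[of q] by (cases "q = 0") auto

lemma padic_abs_rat_mult: "padic_abs_rat p (q * r) = padic_abs_rat p q * padic_abs_rat p r"
proof (cases "q = 0 \<or> r = 0")
  case False
  then obtain a b c d :: int where
    ab: "a \<noteq> 0" "b \<noteq> 0" "q = of_int a / of_int b" and
    cd: "c \<noteq> 0" "d \<noteq> 0" "r = of_int c / of_int d"
    by (metis rat_fraction_cases)
  have pe: "prime_elem (int p)" using prime_int by simp
  have qr: "q * r = of_int (a * c) / of_int (b * d)" by (simp add: ab cd)
  have nz: "a * c \<noteq> 0" "b * d \<noteq> 0" using ab cd by auto
  have "padic_abs_rat p (q * r) =
      real p powi (int (multiplicity (int p) (b * d)) - int (multiplicity (int p) (a * c)))"
    unfolding qr by (rule padic_abs_rat_divide_int[OF nz])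
  also have "\<dots> = real p powi ((int (multiplicity (int p) b) - int (multiplicity (int p) a)) +
        (int (multiplicity (int p) d) - int (multiplicity (int p) c)))"
    by (simp add: ab(1,2) cd(1,2) prime_elem_multiplicity_mult_distrib[OF pe] algebra_simps)
  also have "\<dots> = padic_abs_rat p q * padic_abs_rat p r"
    by (simp add: ab cd padic_abs_rat_divide_int power_int_add)
  finally show ?thesis .
qed auto

lemma padic_abs_rat_1 [simp]: "padic_abs_rat p 1 = 1"
  using padic_abs_rat_divide_int[of 1 1] by simp

lemma padic_abs_rat_minus [simp]: "padic_abs_rat p (- q) = padic_abs_rat p q"
proof -
  have "padic_abs_rat p (-1) = 1"
    using padic_abs_rat_divide_int[of "-1" 1] multiplicity_unit_right[of "-1" "int p"] by simp
  with padic_abs_rat_mult[of "-1" q] show ?thesis by simp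
qed

lemma padic_abs_rat_diff_commute: "padic_abs_rat p (q - r) = padic_abs_rat p (r - q)"
  using padic_abs_rat_minus[of "q - r"] by simp

lemma padic_abs_rat_inverse: "padic_abs_rat p (inverse q) = inverse (padic_abs_rat p q)"
proof (cases "q = 0")
  case False
  have "padic_abs_rat p (inverse q) * padic_abs_rat p q = 1"
    using False by (simp flip: padic_abs_rat_mult)
  thus ?thesis by (metis inverse_unique mult.commute)
qed auto

lemma padic_abs_rat_divide: "padic_abs_rat p (q / r) = padic_abs_rat p q / padic_abs_rat p r"
  by (simp add: divide_inverse padic_abs_rat_mult padic_abs_rat_inverse)

lemma padic_abs_rat_p: "padic_abs_rat p (of_nat p) = inverse (real p)"
proof -
  have "multiplicity (int p) (int p) = 1" using prime_int by simp
  thus ?thesis using padic_abs_rat_divide_int[of "int p" 1] by (simp add: power_int_minus)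
qed

lemma padic_abs_rat_power: "padic_abs_rat p (q ^ n) = padic_abs_rat p q ^ n"
  by (induction n) (auto simp: padic_abs_rat_mult)

lemma padic_abs_rat_powi: "padic_abs_rat p (of_nat p powi k) = real p powi (- k)"
  by (cases "k \<ge> 0")
     (auto simp: power_int_def padic_abs_rat_power padic_abs_rat_inverse padic_abs_rat_p power_inverse)

text \<open>The fractions with denominator prime to p are visibly closed under addition. Describing the
unit ball by them therefore reduces the ultrametric inequality to adding two fractions.\<close>

lemma padic_abs_rat_le_1_iff:
  "padic_abs_rat p q \<le> 1 \<longleftrightarrow> (\<exists>a b. q = of_int a / of_int b \<and> \<not> int p dvd b)"
proof
  assume *: "padic_abs_rat p q \<le> 1"
  show "\<exists>a b. q = of_int a / of_int b \<and> \<not> int p dvd b"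
  proof (cases "q = 0")
    case True
    have "\<not> int p dvd 1" using p_gt_1 by simp
    thus ?thesis using True by (metis div_0 of_int_0)
  next
    case False
    obtain n d where nd: "quotient_of q = (n, d)" by fastforce
    have d: "d > 0" and q: "q = of_int n / of_int d" and cop: "coprime n d"
      using quotient_of_denom_pos[OF nd] quotient_of_div[OF nd] quotient_of_coprime[OF nd] by auto
    have n: "n \<noteq> 0" using q False by auto
    have "\<not> int p dvd d"
    proof
      assume dv: "int p dvd d"
      hence "\<not> int p dvd n" using cop prime_int
        by (metis coprime_common_divisor not_prime_unit)
      hence "multiplicity (int p) n = 0" by (rule not_dvd_imp_multiplicity_0)
      moreover have "multiplicity (int p) d > 0"
        using dv d prime_int by (subst prime_multiplicity_gt_zero_iff) auto
      ultimately have "padic_abs_rat p q = real p ^ multiplicity (int p) d" "multiplicity (int p) d > 0"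
        using padic_abs_rat_divide_int[of n d] n d q by auto
      moreover have "real p ^ multiplicity (int p) d > 1"
        using p_gt_1 calculation(2) by (simp add: one_less_power)
      ultimately show False using * by simp
    qed
    thus ?thesis using q by blast
  qed
next
  assume "\<exists>a b. q = of_int a / of_int b \<and> \<not> int p dvd b"
  then obtain a b where q: "q = of_int a / of_int b" and b: "\<not> int p dvd b" by blast
  show "padic_abs_rat p q \<le> 1"
  proof (cases "q = 0")
    case False
    hence "a \<noteq> 0" "b \<noteq> 0" using q by auto
    hence "padic_abs_rat p q = inverse (real p ^ multiplicity (int p) a)"
      using q padic_abs_rat_divide_int[of a b] not_dvd_imp_multiplicity_0[OF b]
      by (simp add: power_int_minus)
    also have "\<dots> \<le> 1"
    proof -
      have "1 \<le> real p ^ multiplicity (int p) a" using p_gt_1 by (intro one_le_power) auto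
      thus ?thesis by (rule inverse_le_1_iff[THEN iffD2, OF disjI2])
    qed
    finally show ?thesis .
  qed auto
qed

lemma padic_abs_rat_of_int_le_1: "padic_abs_rat p (of_int k) \<le> 1"
proof -
  have "\<not> int p dvd 1" using p_gt_1 by simp
  thus ?thesis unfolding padic_abs_rat_le_1_iff by (metis div_by_1 of_int_1)
qed

text \<open>By multiplicativity one may divide by the summand of larger absolute value. What remains is that
\<open>1 + s\<close> lies in the unit ball when \<open>s\<close> does.\<close>

lemma padic_abs_rat_add_le: "padic_abs_rat p (q + r) \<le> max (padic_abs_rat p q) (padic_abs_rat p r)"
proof -
  have unit: "padic_abs_rat p (1 + s) \<le> 1" if s: "padic_abs_rat p s \<le> 1" for s
  proof -
    obtain a b where ab: "s = of_int a / of_int b" "\<not> int p dvd b"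
      using s unfolding padic_abs_rat_le_1_iff by blast
    hence "b \<noteq> 0" by auto
    hence "1 + s = of_int (b + a) / of_int b" by (simp add: ab field_simps)
    thus ?thesis using ab(2) unfolding padic_abs_rat_le_1_iff by blast
  qed
  have main: "padic_abs_rat p (q + r) \<le> padic_abs_rat p q"
    if le: "padic_abs_rat p r \<le> padic_abs_rat p q" for q r
  proof (cases "q = 0")
    case True
    thus ?thesis using le by (simp add: antisym)
  next
    case False
    have "padic_abs_rat p (r / q) \<le> 1"
      using le padic_abs_rat_pos[OF False] by (simp add: padic_abs_rat_divide)
    hence "padic_abs_rat p (1 + r / q) \<le> 1" by (rule unit)
    hence "padic_abs_rat p q * padic_abs_rat p (1 + r / q) \<le> padic_abs_rat p q"
      by (simp add: mult_left_le)
    moreover have "q * (1 + r / q) = q + r" using False by (simp add: field_simps)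
    ultimately show ?thesis by (simp flip: padic_abs_rat_mult)
  qed
  show ?thesis
    using main[of r q] main[of q r] by (cases "padic_abs_rat p r \<le> padic_abs_rat p q") (auto simp: add.commute)
qed

lemma padic_abs_rat_reverse_triangle:
  "\<bar>padic_abs_rat p q - padic_abs_rat p r\<bar> \<le> padic_abs_rat p (q - r)"
proof -
  have "padic_abs_rat p q \<le> max (padic_abs_rat p (q - r)) (padic_abs_rat p r)"
    "padic_abs_rat p r \<le> max (padic_abs_rat p (q - r)) (padic_abs_rat p q)"
    using padic_abs_rat_add_le[of "q - r" r] padic_abs_rat_add_le[of "r - q" q]
    by (simp_all add: padic_abs_rat_diff_commute)
  with padic_abs_rat_nonneg[of q] padic_abs_rat_nonneg[of r] padic_abs_rat_nonneg[of "q - r"]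
  show ?thesis by linarith
qed

section \<open>Fractions whose denominator is a power of p\<close>

text \<open>The ring \<open>\<int>[1/p]\<close>. It meets \<open>\<int>\<^sub>p\<close> exactly in the integers, and together they span \<open>\<rat>\<^sub>p\<close>; these
two facts drive everything below.\<close>

definition p_fractions :: "rat set" where
  "p_fractions = {of_int m / of_nat p ^ e | m e. True}"

lemma p_fractions_of_int [simp]: "of_int m \<in> p_fractions"
  unfolding p_fractions_def by (rule CollectI, rule exI[of _ m], rule exI[of _ 0]) simp

lemma p_fractions_0 [simp]: "0 \<in> p_fractions"
  using p_fractions_of_int[of 0] by simp

lemma p_fractions_add:
  assumes "q \<in> p_fractions" "r \<in> p_fractions" shows "q + r \<in> p_fractions"
proof -
  obtain m e n f where "q = of_int m / of_nat p ^ e" "r = of_int n / of_nat p ^ f"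
    using assms unfolding p_fractions_def by blast
  hence "q + r = of_int (m * int p ^ f + n * int p ^ e) / of_nat p ^ (e + f)"
    by (simp add: power_add add_divide_distrib)
  thus ?thesis unfolding p_fractions_def by blast
qed

lemma p_fractions_mult:
  assumes "q \<in> p_fractions" "r \<in> p_fractions" shows "q * r \<in> p_fractions"
proof -
  obtain m e n f where "q = of_int m / of_nat p ^ e" "r = of_int n / of_nat p ^ f"
    using assms unfolding p_fractions_def by blast
  hence "q * r = of_int (m * n) / of_nat p ^ (e + f)"
    by (simp add: power_add)
  thus ?thesis unfolding p_fractions_def by blast
qed

lemma p_fractions_minus: "q \<in> p_fractions \<Longrightarrow> - q \<in> p_fractions"
  using p_fractions_mult[OF p_fractions_of_int[of "-1"]] by simp

lemma p_fractions_diff: "q \<in> p_fractions \<Longrightarrow> r \<in> p_fractions \<Longrightarrow> q - r \<in> p_fractions"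
  using p_fractions_add[OF _ p_fractions_minus] by fastforce

lemma p_fractions_powi: "of_nat p powi k \<in> p_fractions"
proof (cases "k \<ge> 0")
  case True
  hence "of_nat p powi k = (of_int (int p ^ nat k) :: rat)" by (simp add: power_int_def)
  thus ?thesis by (metis p_fractions_of_int)
next
  case False
  hence "of_nat p powi k = (of_int 1 / of_nat p ^ nat (- k) :: rat)"
    by (simp add: power_int_def divide_inverse power_inverse)
  thus ?thesis unfolding p_fractions_def by blast
qed

lemma p_fractions_sum: "(\<And>i. i \<in> I \<Longrightarrow> f i \<in> p_fractions) \<Longrightarrow> sum f I \<in> p_fractions"
  by (induction I rule: infinite_finite_induct) (auto intro: p_fractions_add)

text \<open>Such a number has one denominator that is a power of p and another that is prime to p.\<close>

lemma p_fractions_abs_le_1_imp_int: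
  assumes "q \<in> p_fractions" "padic_abs_rat p q \<le> 1"
  shows "q \<in> \<int>"
proof -
  obtain m e where q: "q = of_int m / of_nat p ^ e" using assms unfolding p_fractions_def by blast
  obtain a b where ab: "q = of_int a / of_int b" "\<not> int p dvd b"
    using assms(2) unfolding padic_abs_rat_le_1_iff by blast
  have b: "b \<noteq> 0" using ab by auto
  have "(of_int (m * b) :: rat) = of_int (a * int p ^ e)"
    using q ab(1) b by (simp add: field_simps)
  hence "m * b = a * int p ^ e" by (simp only: of_int_eq_iff)
  moreover have "coprime (int p ^ e) b"
    using ab(2) prime_int by (simp add: prime_imp_coprime coprime_power_left_iff)
  ultimately have "int p ^ e dvd m"
    by (metis coprime_dvd_mult_left_iff dvd_triv_right)
  then obtain c where "m = int p ^ e * c" by blast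
  hence "q = of_int c" using q by simp
  thus ?thesis by simp
qed

text \<open>Write \<open>q\<close> as \<open>a / (b p\<^sup>e)\<close> with \<open>b\<close> prime to p. Modulo \<open>p\<^sup>e\<close> the denominator \<open>b\<close> is invertible, and
the residue \<open>m\<close> of \<open>a / b\<close> gives the fractional part \<open>m / p\<^sup>e\<close>.\<close>

lemma p_fraction_approx:
  obtains r where "r \<in> p_fractions" "0 \<le> r" "r < 1" "padic_abs_rat p (q - r) \<le> 1"
proof -
  (* a power of p large enough to clear the p-part of the denominator *)
  obtain e where e: "padic_abs_rat p q < real p ^ e"
    using real_arch_pow[of "real p"] p_gt_1 by auto
  have pe: "padic_abs_rat p (of_nat p ^ e) = inverse (real p ^ e)"
    by (simp add: padic_abs_rat_power padic_abs_rat_p power_inverse)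
  have "padic_abs_rat p (q * of_nat p ^ e) \<le> 1"
    using e by (simp add: padic_abs_rat_mult pe field_simps)
  then obtain a b where ab: "q * of_nat p ^ e = of_int a / of_int b" "\<not> int p dvd b"
    unfolding padic_abs_rat_le_1_iff by blast
  have b: "b \<noteq> 0" using ab by auto
  have "coprime b (int p ^ e)"
    using ab(2) prime_int by (metis coprime_commute prime_imp_coprime coprime_power_right_iff)
  then obtain c where c: "[b * c = 1] (mod int p ^ e)"
    using cong_solve_coprime_int by blast
  define m where "m = (a * c) mod int p ^ e"
  have "[b * m = b * (a * c)] (mod int p ^ e)"
    unfolding m_def by (simp add: cong_def mod_mult_right_eq)
  also have "[b * (a * c) = a] (mod int p ^ e)"
    using cong_mult[OF cong_refl[of a] c] by (simp add: mult_ac)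
  finally have "int p ^ e dvd a - b * m"
    by (metis cong_iff_dvd_diff cong_sym)
  then obtain d where d: "a - b * m = int p ^ e * d" by blast
  have m: "0 \<le> m" "m < int p ^ e" by (simp_all add: m_def)
  show ?thesis
  proof (rule that[of "of_int m / of_nat p ^ e"])
    show "of_int m / of_nat p ^ e \<in> p_fractions" unfolding p_fractions_def by blast
    show "0 \<le> (of_int m / of_nat p ^ e :: rat)" using m by simp
    have "(of_int m :: rat) < of_int (int p ^ e)" using m(2) by (simp only: of_int_less_iff)
    thus "(of_int m / of_nat p ^ e :: rat) < 1" by simp
    have "(q - of_int m / of_nat p ^ e) * of_nat p ^ e = of_int a / of_int b - of_int m"
      by (simp add: left_diff_distrib ab(1))
    also have "\<dots> = of_int (a - b * m) / of_int b"
      using b by (simp add: field_simps)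
    also have "\<dots> = of_int d / of_int b * of_nat p ^ e"
      by (simp add: d)
    finally have "q - of_int m / of_nat p ^ e = of_int d / of_int b"
      by (subst (asm) mult_right_cancel) simp
    thus "padic_abs_rat p (q - of_int m / of_nat p ^ e) \<le> 1"
      unfolding padic_abs_rat_le_1_iff using ab(2) by blast
  qed
qed

text \<open>After division by \<open>p\<^sup>k\<close> the difference is a p-adically integral element of \<open>\<int>[1/p]\<close>, hence an
integer, and its real absolute value is less than 1.\<close>

lemma p_fraction_unique:
  assumes "r \<in> p_fractions" "0 \<le> r" "r < of_nat p powi k"
    and "s \<in> p_fractions" "0 \<le> s" "s < of_nat p powi k"
    and "padic_abs_rat p (r - s) \<le> real p powi (- k)"
  shows "r = s"
proof -
  define t where "t = (r - s) * of_nat p powi (- k)"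
  have pos: "(of_nat p powi k :: rat) > 0" by (simp add: zero_less_power_int)
  have inv: "(of_nat p powi (- k) :: rat) = inverse (of_nat p powi k)" by (simp add: power_int_minus)
  have "t \<in> p_fractions"
    unfolding t_def by (intro p_fractions_mult p_fractions_diff p_fractions_powi assms)
  moreover have "padic_abs_rat p t \<le> 1"
  proof -
    have "padic_abs_rat p t = padic_abs_rat p (r - s) * real p powi k"
      by (simp add: t_def padic_abs_rat_mult padic_abs_rat_powi)
    also have "\<dots> \<le> real p powi (- k) * real p powi k"
      by (intro mult_right_mono assms(7)) simp
    finally show ?thesis by (simp add: power_int_minus)
  qed
  ultimately have "t \<in> \<int>" by (rule p_fractions_abs_le_1_imp_int)
  moreover have "\<bar>t\<bar> < 1"
  proof -
    have "\<bar>r - s\<bar> < of_nat p powi k" using assms by linarith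
    thus ?thesis using pos by (simp add: t_def inv abs_mult field_simps)
  qed
  ultimately have "t = 0" by (auto elim!: Ints_cases simp flip: of_int_abs)
  thus ?thesis by (simp add: t_def)
qed

section \<open>The additive group of the p-adic numbers\<close>

lemma padic_CauchyD:
  assumes "padic_Cauchy p s" "e > 0"
  obtains M where "\<And>m n. m \<ge> M \<Longrightarrow> n \<ge> M \<Longrightarrow> padic_abs_rat p (s m - s n) < e"
  using assms unfolding padic_Cauchy_def by blast

lemma padic_Cauchy_const [simp]: "padic_Cauchy p (\<lambda>_. q)"
  by (simp add: padic_Cauchy_def)

lemma padic_Cauchy_add:
  assumes "padic_Cauchy p s" "padic_Cauchy p t"
  shows "padic_Cauchy p (\<lambda>n. s n + t n)"
  unfolding padic_Cauchy_def
proof (intro allI impI)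
  fix e :: real assume e: "e > 0"
  obtain M N where
    M: "\<And>m n. m \<ge> M \<Longrightarrow> n \<ge> M \<Longrightarrow> padic_abs_rat p (s m - s n) < e" and
    N: "\<And>m n. m \<ge> N \<Longrightarrow> n \<ge> N \<Longrightarrow> padic_abs_rat p (t m - t n) < e"
    using padic_CauchyD[OF assms(1) e] padic_CauchyD[OF assms(2) e] by metis
  have "padic_abs_rat p (s m + t m - (s n + t n)) < e" if "m \<ge> max M N" "n \<ge> max M N" for m n
    using that M[of m n] N[of m n] padic_abs_rat_add_le[of "s m - s n" "t m - t n"]
    by (simp add: algebra_simps)
  thus "\<exists>M. \<forall>m\<ge>M. \<forall>n\<ge>M. padic_abs_rat p (s m + t m - (s n + t n)) < e" by blast
qed

lemma padic_Cauchy_minus: "padic_Cauchy p s \<Longrightarrow> padic_Cauchy p (\<lambda>n. - s n)"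
  unfolding padic_Cauchy_def by (metis padic_abs_rat_diff_commute minus_diff_minus padic_abs_rat_minus)

lemma padic_Cauchy_diff:
  "padic_Cauchy p s \<Longrightarrow> padic_Cauchy p t \<Longrightarrow> padic_Cauchy p (\<lambda>n. s n - t n)"
  using padic_Cauchy_add[OF _ padic_Cauchy_minus] by fastforce

lemma Cauchy_ring_simps [simp]:
  "s \<in> carrier (Cauchy_ring p) \<longleftrightarrow> padic_Cauchy p s"
  "s \<oplus>\<^bsub>Cauchy_ring p\<^esub> t = (\<lambda>n. s n + t n)"
  "\<zero>\<^bsub>Cauchy_ring p\<^esub> = (\<lambda>_. 0)"
  by (simp_all add: Cauchy_ring_def)

lemma Cauchy_abelian_group: "abelian_group (Cauchy_ring p)"
proof (rule abelian_groupI)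
  fix s assume "s \<in> carrier (Cauchy_ring p)"
  thus "\<exists>t\<in>carrier (Cauchy_ring p). t \<oplus>\<^bsub>Cauchy_ring p\<^esub> s = \<zero>\<^bsub>Cauchy_ring p\<^esub>"
    by (intro bexI[of _ "\<lambda>n. - s n"]) (auto intro: padic_Cauchy_minus)
qed (auto intro: padic_Cauchy_add simp: algebra_simps)

lemma Cauchy_a_inv: "padic_Cauchy p s \<Longrightarrow> \<ominus>\<^bsub>Cauchy_ring p\<^esub> s = (\<lambda>n. - s n)"
  by (rule abelian_group.minus_equality[OF Cauchy_abelian_group]) (auto intro: padic_Cauchy_minus)

lemma null_idealI:
  "padic_Cauchy p s \<Longrightarrow> (\<lambda>n. padic_abs_rat p (s n)) \<longlonglongrightarrow> 0 \<Longrightarrow> s \<in> null_ideal p"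
  by (simp add: null_ideal_def)

text \<open>The p-adic numbers form the quotient group of Cauchy sequences by null sequences. Closure of the
null sequences under addition is the ultrametric inequality.\<close>

lemma null_ideal_subgroup: "abelian_subgroup (null_ideal p) (Cauchy_ring p)"
proof (rule abelian_subgroupI3)
  interpret C: abelian_group "Cauchy_ring p" by (rule Cauchy_abelian_group)
  show "additive_subgroup (null_ideal p) (Cauchy_ring p)"
  proof (rule additive_subgroup.intro, rule C.add.subgroupI)
    show "null_ideal p \<subseteq> carrier (Cauchy_ring p)"
      by (auto simp: null_ideal_def)
    show "null_ideal p \<noteq> {}"
      using null_idealI[of "\<lambda>_. 0"] by auto
  next
    fix s assume "s \<in> null_ideal p"
    thus "\<ominus>\<^bsub>Cauchy_ring p\<^esub> s \<in> null_ideal p"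
      by (auto simp: null_ideal_def Cauchy_a_inv padic_Cauchy_minus)
  next
    fix s t assume s: "s \<in> null_ideal p" and t: "t \<in> null_ideal p"
    have "(\<lambda>n. padic_abs_rat p (s n + t n)) \<longlonglongrightarrow> 0"
    proof (rule Lim_null_comparison)
      show "\<forall>\<^sub>F n in sequentially. norm (padic_abs_rat p (s n + t n))
          \<le> max (padic_abs_rat p (s n)) (padic_abs_rat p (t n))"
        using padic_abs_rat_add_le by simp
      show "(\<lambda>n. max (padic_abs_rat p (s n)) (padic_abs_rat p (t n))) \<longlonglongrightarrow> 0"
        using tendsto_max[of "\<lambda>n. padic_abs_rat p (s n)" 0 sequentially "\<lambda>n. padic_abs_rat p (t n)" 0] s t
        by (simp add: null_ideal_def)
    qed
    thus "s \<oplus>\<^bsub>Cauchy_ring p\<^esub> t \<in> null_ideal p"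
      using s t by (auto simp: null_ideal_def intro: padic_Cauchy_add)
  qed
qed (rule Cauchy_abelian_group)

sublocale N: abelian_subgroup "null_ideal p" "Cauchy_ring p"
  by (rule null_ideal_subgroup)

text \<open>The additive part of the quotient ring is literally the quotient group, so the p-adic numbers
inherit its group laws.\<close>

lemma add_monoid_Qp: "add_monoid (Qp p) = Cauchy_ring p A_Mod null_ideal p"
  by (simp add: Qp_def FactRing_def A_FactGroup_def')

sublocale Q: abelian_group "Qp p"
proof -
  have "comm_group (add_monoid (Qp p))"
    unfolding add_monoid_Qp by (rule N.a_factorgroup_is_comm_group)
  thus "abelian_group (Qp p)"
    by (intro abelian_group.intro abelian_monoid.intro abelian_group_axioms.intro comm_group.axioms(1))
qed

definition Qp_class :: "(nat \<Rightarrow> rat) \<Rightarrow> (nat \<Rightarrow> rat) set" where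
  "Qp_class s = null_ideal p +>\<^bsub>Cauchy_ring p\<^esub> s"

lemma Qp_of_rat_eq: "Qp_of_rat p q = Qp_class (\<lambda>_. q)"
  by (simp add: Qp_of_rat_def Qp_class_def)

lemma Qp_class_closed [simp]: "padic_Cauchy p s \<Longrightarrow> Qp_class s \<in> carrier (Qp p)"
  unfolding Qp_class_def Qp_def FactRing_def by (simp add: N.a_rcosetsI N.a_subset)

lemma Qp_cases:
  assumes "x \<in> carrier (Qp p)"
  obtains s where "padic_Cauchy p s" "x = Qp_class s"
  using assms unfolding Qp_class_def Qp_def FactRing_def A_RCOSETS_def' by auto

lemma Qp_class_add:
  "padic_Cauchy p s \<Longrightarrow> padic_Cauchy p t \<Longrightarrow>
    Qp_class s \<oplus>\<^bsub>Qp p\<^esub> Qp_class t = Qp_class (\<lambda>n. s n + t n)"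
  unfolding Qp_class_def Qp_def FactRing_def by (simp add: N.a_rcos_sum)

lemma Qp_zero: "\<zero>\<^bsub>Qp p\<^esub> = Qp_class (\<lambda>_. 0)"
proof -
  have "Qp_class (\<lambda>_. 0) = null_ideal p"
    unfolding Qp_class_def
    using abelian_group.a_coset_add_zero[OF Cauchy_abelian_group N.a_subset] by simp
  thus ?thesis by (simp add: Qp_def FactRing_def)
qed

lemma Qp_class_minus:
  "padic_Cauchy p s \<Longrightarrow> \<ominus>\<^bsub>Qp p\<^esub> Qp_class s = Qp_class (\<lambda>n. - s n)"
  by (rule Q.minus_equality) (auto simp: Qp_class_add Qp_zero padic_Cauchy_minus)

lemma Qp_class_diff:
  "padic_Cauchy p s \<Longrightarrow> padic_Cauchy p t \<Longrightarrow>
    Qp_class s \<ominus>\<^bsub>Qp p\<^esub> Qp_class t = Qp_class (\<lambda>n. s n - t n)"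
  by (simp add: a_minus_def Qp_class_minus Qp_class_add padic_Cauchy_minus)

lemmas Qp_class_simps = Qp_class_add Qp_class_minus Qp_class_diff Qp_zero Qp_of_rat_eq
  padic_Cauchy_add padic_Cauchy_minus padic_Cauchy_diff

lemma Qp_of_rat_closed [simp]: "Qp_of_rat p q \<in> carrier (Qp p)"
  by (simp add: Qp_of_rat_eq)

lemma Qp_of_rat_diff: "Qp_of_rat p (q - r) = Qp_of_rat p q \<ominus>\<^bsub>Qp p\<^esub> Qp_of_rat p r"
  by (simp add: Qp_class_simps)

lemma Qp_of_rat_0 [simp]: "Qp_of_rat p 0 = \<zero>\<^bsub>Qp p\<^esub>"
  by (simp add: Qp_class_simps)

lemma mem_Qp_class:
  assumes "padic_Cauchy p s"
  shows "t \<in> Qp_class s \<longleftrightarrow> (\<exists>h\<in>null_ideal p. t = (\<lambda>n. h n + s n))"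
  by (simp add: Qp_class_def a_r_coset_def')

section \<open>The absolute value on the p-adic numbers and completeness\<close>

lemma padic_abs_rat_convergent:
  assumes "padic_Cauchy p s"
  shows "convergent (\<lambda>n. padic_abs_rat p (s n))"
proof -
  have "Cauchy (\<lambda>n. padic_abs_rat p (s n))"
  proof (rule metric_CauchyI)
    fix e :: real assume "e > 0"
    then obtain M where M: "\<And>m n. m \<ge> M \<Longrightarrow> n \<ge> M \<Longrightarrow> padic_abs_rat p (s m - s n) < e"
      using padic_CauchyD[OF assms] by metis
    show "\<exists>M. \<forall>m\<ge>M. \<forall>n\<ge>M. dist (padic_abs_rat p (s m)) (padic_abs_rat p (s n)) < e"
      unfolding dist_real_def using M padic_abs_rat_reverse_triangle by (meson le_less_trans)
  qed
  thus ?thesis by (rule Cauchy_convergent)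
qed

text \<open>The limit exists by the reverse triangle inequality, and adding a null sequence does not change
it. This identifies the description of the absolute value of a class, which quantifies over all
representatives, with the limit along a single representative.\<close>

lemma padic_abs_class_tendsto:
  assumes "padic_Cauchy p s"
  shows "(\<lambda>n. padic_abs_rat p (s n)) \<longlonglongrightarrow> padic_abs p (Qp_class s)"
proof -
  obtain r where r: "(\<lambda>n. padic_abs_rat p (s n)) \<longlonglongrightarrow> r"
    using padic_abs_rat_convergent[OF assms] by (auto simp: convergent_def)
  have all: "(\<lambda>n. padic_abs_rat p (t n)) \<longlonglongrightarrow> r" if t: "t \<in> Qp_class s" for t
  proof -
    obtain h where h: "h \<in> null_ideal p" "t = (\<lambda>n. h n + s n)"
      using t by (auto simp: mem_Qp_class[OF assms])
    have "(\<lambda>n. padic_abs_rat p (t n) - padic_abs_rat p (s n)) \<longlonglongrightarrow> 0"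
    proof (rule Lim_null_comparison)
      show "\<forall>\<^sub>F n in sequentially.
        norm (padic_abs_rat p (t n) - padic_abs_rat p (s n)) \<le> padic_abs_rat p (h n)"
        using padic_abs_rat_reverse_triangle[of "h n + s n" "s n" for n] by (simp add: h(2))
    qed (use h in \<open>simp add: null_ideal_def\<close>)
    from tendsto_add[OF this r] show ?thesis by simp
  qed
  have "s \<in> Qp_class s"
    unfolding mem_Qp_class[OF assms] by (rule bexI[of _ "\<lambda>_. 0"]) (auto intro: null_idealI)
  hence "padic_abs p (Qp_class s) = r"
    unfolding padic_abs_def by (intro the_equality) (use all LIMSEQ_unique in blast)+
  thus ?thesis using r by simp
qed

lemma padic_abs_of_rat [simp]: "padic_abs p (Qp_of_rat p q) = padic_abs_rat p q"
  using padic_abs_class_tendsto[of "\<lambda>_. q"] by (simp add: Qp_of_rat_eq LIMSEQ_const_iff)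

lemma padic_abs_zero [simp]: "padic_abs p \<zero>\<^bsub>Qp p\<^esub> = 0"
  using padic_abs_of_rat[of 0] by simp

lemma padic_abs_nonneg [simp]:
  assumes "x \<in> carrier (Qp p)" shows "padic_abs p x \<ge> 0"
  using assms
  by (auto elim!: Qp_cases intro: LIMSEQ_le_const[OF padic_abs_class_tendsto])

lemma padic_abs_eq_0_iff:
  assumes "x \<in> carrier (Qp p)"
  shows "padic_abs p x = 0 \<longleftrightarrow> x = \<zero>\<^bsub>Qp p\<^esub>"
proof
  assume *: "padic_abs p x = 0"
  obtain s where s: "padic_Cauchy p s" "x = Qp_class s" using assms by (rule Qp_cases)
  hence "s \<in> null_ideal p" using * padic_abs_class_tendsto[of s] by (auto intro: null_idealI)
  hence "x = null_ideal p" unfolding s(2) Qp_class_def by (rule N.a_rcos_const)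
  thus "x = \<zero>\<^bsub>Qp p\<^esub>" by (simp add: Qp_def FactRing_def)
qed simp

lemma padic_abs_add_le:
  assumes "x \<in> carrier (Qp p)" "y \<in> carrier (Qp p)"
  shows "padic_abs p (x \<oplus>\<^bsub>Qp p\<^esub> y) \<le> max (padic_abs p x) (padic_abs p y)"
proof -
  obtain s t where s: "padic_Cauchy p s" "x = Qp_class s" and t: "padic_Cauchy p t" "y = Qp_class t"
    using assms by (metis Qp_cases)
  show ?thesis
  proof (rule LIMSEQ_le)
    show "(\<lambda>n. padic_abs_rat p (s n + t n)) \<longlonglongrightarrow> padic_abs p (x \<oplus>\<^bsub>Qp p\<^esub> y)"
      unfolding s(2) t(2) Qp_class_add[OF s(1) t(1)]
      by (intro padic_abs_class_tendsto padic_Cauchy_add s t)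
    show "(\<lambda>n. max (padic_abs_rat p (s n)) (padic_abs_rat p (t n)))
            \<longlonglongrightarrow> max (padic_abs p x) (padic_abs p y)"
      unfolding s(2) t(2) by (intro tendsto_max padic_abs_class_tendsto s t)
  qed (use padic_abs_rat_add_le in blast)
qed

lemma padic_abs_minus [simp]:
  assumes "x \<in> carrier (Qp p)" shows "padic_abs p (\<ominus>\<^bsub>Qp p\<^esub> x) = padic_abs p x"
proof -
  obtain s where s: "padic_Cauchy p s" "x = Qp_class s" using assms by (rule Qp_cases)
  show ?thesis
    using padic_abs_class_tendsto[OF s(1)] padic_abs_class_tendsto[OF padic_Cauchy_minus[OF s(1)]]
    by (simp add: s Qp_class_minus LIMSEQ_unique)
qed

lemma padic_abs_diff_le:
  assumes "x \<in> carrier (Qp p)" "y \<in> carrier (Qp p)"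
  shows "padic_abs p (x \<ominus>\<^bsub>Qp p\<^esub> y) \<le> max (padic_abs p x) (padic_abs p y)"
  using padic_abs_add_le[of x "\<ominus>\<^bsub>Qp p\<^esub> y"] assms by (simp add: a_minus_def)

lemma Qp_diff_add_diff:
  assumes "x \<in> carrier (Qp p)" "y \<in> carrier (Qp p)" "z \<in> carrier (Qp p)"
  shows "(x \<ominus>\<^bsub>Qp p\<^esub> y) \<oplus>\<^bsub>Qp p\<^esub> (y \<ominus>\<^bsub>Qp p\<^esub> z) = x \<ominus>\<^bsub>Qp p\<^esub> z"
  using assms by (elim Qp_cases) (simp add: Qp_class_simps)

lemma Qp_diff_zero [simp]: "x \<in> carrier (Qp p) \<Longrightarrow> x \<ominus>\<^bsub>Qp p\<^esub> \<zero>\<^bsub>Qp p\<^esub> = x"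
  by (elim Qp_cases) (simp add: Qp_class_simps)

lemma Qp_diff_commute:
  assumes "x \<in> carrier (Qp p)" "y \<in> carrier (Qp p)"
  shows "\<ominus>\<^bsub>Qp p\<^esub> (x \<ominus>\<^bsub>Qp p\<^esub> y) = y \<ominus>\<^bsub>Qp p\<^esub> x"
  using assms by (elim Qp_cases) (simp add: Qp_class_simps)

lemma Qp_diff_eq_0_iff:
  assumes "x \<in> carrier (Qp p)" "y \<in> carrier (Qp p)"
  shows "x \<ominus>\<^bsub>Qp p\<^esub> y = \<zero>\<^bsub>Qp p\<^esub> \<longleftrightarrow> x = y"
proof
  assume "x \<ominus>\<^bsub>Qp p\<^esub> y = \<zero>\<^bsub>Qp p\<^esub>"
  thus "x = y" using Qp_diff_add_diff[of x y "\<zero>\<^bsub>Qp p\<^esub>"] assms by simp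
next
  assume "x = y"
  thus "x \<ominus>\<^bsub>Qp p\<^esub> y = \<zero>\<^bsub>Qp p\<^esub>" using assms by (simp add: a_minus_def Q.r_neg)
qed

lemma padic_abs_diff_commute:
  assumes "x \<in> carrier (Qp p)" "y \<in> carrier (Qp p)"
  shows "padic_abs p (x \<ominus>\<^bsub>Qp p\<^esub> y) = padic_abs p (y \<ominus>\<^bsub>Qp p\<^esub> x)"
  using padic_abs_minus[of "x \<ominus>\<^bsub>Qp p\<^esub> y"] Qp_diff_commute[OF assms] assms by simp

lemma padic_abs_diff_triangle:
  assumes "x \<in> carrier (Qp p)" "y \<in> carrier (Qp p)" "z \<in> carrier (Qp p)"
  shows "padic_abs p (x \<ominus>\<^bsub>Qp p\<^esub> z)
    \<le> max (padic_abs p (x \<ominus>\<^bsub>Qp p\<^esub> y)) (padic_abs p (y \<ominus>\<^bsub>Qp p\<^esub> z))"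
  using padic_abs_add_le[of "x \<ominus>\<^bsub>Qp p\<^esub> y" "y \<ominus>\<^bsub>Qp p\<^esub> z"] Qp_diff_add_diff[OF assms] assms by simp

lemma padic_abs_diff_le_common:
  assumes "x \<in> carrier (Qp p)" "y \<in> carrier (Qp p)" "z \<in> carrier (Qp p)"
    and "padic_abs p (y \<ominus>\<^bsub>Qp p\<^esub> x) \<le> e" "padic_abs p (y \<ominus>\<^bsub>Qp p\<^esub> z) \<le> e"
  shows "padic_abs p (x \<ominus>\<^bsub>Qp p\<^esub> z) \<le> e"
  using padic_abs_diff_triangle[OF assms(1-3)] padic_abs_diff_commute[OF assms(1,2)] assms(4,5)
  by linarith

lemma Qp_rat_approx:
  assumes "x \<in> carrier (Qp p)" "e > 0"
  obtains q where "padic_abs p (x \<ominus>\<^bsub>Qp p\<^esub> Qp_of_rat p q) < e"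
proof -
  obtain s where s: "padic_Cauchy p s" "x = Qp_class s" using assms(1) by (rule Qp_cases)
  obtain M where M: "\<And>m n. m \<ge> M \<Longrightarrow> n \<ge> M \<Longrightarrow> padic_abs_rat p (s m - s n) < e / 2"
    using padic_CauchyD[OF s(1), of "e / 2"] assms(2) by auto
  have "x \<ominus>\<^bsub>Qp p\<^esub> Qp_of_rat p (s M) = Qp_class (\<lambda>n. s n - s M)"
    by (simp add: s Qp_class_simps)
  moreover have "(\<lambda>n. padic_abs_rat p (s n - s M)) \<longlonglongrightarrow> padic_abs p (Qp_class (\<lambda>n. s n - s M))"
    by (intro padic_abs_class_tendsto padic_Cauchy_diff s padic_Cauchy_const)
  hence "padic_abs p (Qp_class (\<lambda>n. s n - s M)) \<le> e / 2"
    by (rule LIMSEQ_le_const2) (use M in \<open>auto intro!: exI[of _ M] less_imp_le\<close>)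
  ultimately show ?thesis using assms(2) by (intro that[of "s M"]) auto
qed

text \<open>Replace each \<open>X n\<close> by a rational number at distance less than \<open>1 / (n + 1)\<close>. These rationals form a
Cauchy sequence, and its class is the limit.\<close>

lemma Qp_complete:
  assumes X: "\<And>n. X n \<in> carrier (Qp p)"
    and Cau: "\<And>e. e > 0 \<Longrightarrow> \<exists>M. \<forall>m\<ge>M. \<forall>n\<ge>M. padic_abs p (X m \<ominus>\<^bsub>Qp p\<^esub> X n) < e"
  obtains x where "x \<in> carrier (Qp p)" "(\<lambda>n. padic_abs p (X n \<ominus>\<^bsub>Qp p\<^esub> x)) \<longlonglongrightarrow> 0"
proof -
  have "\<exists>q. padic_abs p (X n \<ominus>\<^bsub>Qp p\<^esub> Qp_of_rat p q) < inverse (real (Suc n))" for n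
    using Qp_rat_approx[OF X, of "inverse (real (Suc n))" n] by auto
  then obtain s where s: "\<And>n. padic_abs p (X n \<ominus>\<^bsub>Qp p\<^esub> Qp_of_rat p (s n)) < inverse (real (Suc n))"
    by metis
  have small: "\<exists>M. \<forall>n\<ge>M. padic_abs p (X n \<ominus>\<^bsub>Qp p\<^esub> Qp_of_rat p (s n)) < e" if "e > 0" for e
  proof -
    obtain M where "inverse (real (Suc M)) < e" using reals_Archimedean \<open>e > 0\<close> by blast
    moreover have "inverse (real (Suc n)) \<le> inverse (real (Suc M))" if "n \<ge> M" for n
      using that by (intro le_imp_inverse_le) auto
    ultimately show ?thesis using s by (meson le_less_trans less_le_trans order.strict_trans)
  qed
  have cs: "padic_Cauchy p s"
    unfolding padic_Cauchy_def
  proof (intro allI impI)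
    fix e :: real assume e: "e > 0"
    obtain M N where
      M: "\<And>m n. m \<ge> M \<Longrightarrow> n \<ge> M \<Longrightarrow> padic_abs p (X m \<ominus>\<^bsub>Qp p\<^esub> X n) < e" and
      N: "\<And>n. n \<ge> N \<Longrightarrow> padic_abs p (X n \<ominus>\<^bsub>Qp p\<^esub> Qp_of_rat p (s n)) < e"
      using Cau[OF e] small[OF e] by metis
    have "padic_abs_rat p (s m - s n) < e" if "m \<ge> max M N" "n \<ge> max M N" for m n
    proof -
      have "padic_abs p (Qp_of_rat p (s m) \<ominus>\<^bsub>Qp p\<^esub> X m) < e"
        using N[of m] that X by (simp add: padic_abs_diff_commute)
      moreover have "padic_abs p (X m \<ominus>\<^bsub>Qp p\<^esub> Qp_of_rat p (s n)) < e"
        using padic_abs_diff_triangle[of "X m" "X n" "Qp_of_rat p (s n)"] X M[of m n] N[of n] that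
        by simp
      ultimately have "padic_abs p (Qp_of_rat p (s m) \<ominus>\<^bsub>Qp p\<^esub> Qp_of_rat p (s n)) < e"
        using padic_abs_diff_triangle[of "Qp_of_rat p (s m)" "X m" "Qp_of_rat p (s n)"] X by simp
      thus ?thesis by (simp flip: Qp_of_rat_diff)
    qed
    thus "\<exists>M. \<forall>m\<ge>M. \<forall>n\<ge>M. padic_abs_rat p (s m - s n) < e" by blast
  qed
  have "(\<lambda>n. padic_abs p (X n \<ominus>\<^bsub>Qp p\<^esub> Qp_class s)) \<longlonglongrightarrow> 0"
  proof (rule LIMSEQ_I)
    fix e :: real assume e: "e > 0"
    obtain M where M: "\<And>m n. m \<ge> M \<Longrightarrow> n \<ge> M \<Longrightarrow> padic_abs_rat p (s m - s n) < e / 2"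
      using padic_CauchyD[OF cs, of "e / 2"] e by auto
    obtain N where N: "\<And>n. n \<ge> N \<Longrightarrow> padic_abs p (X n \<ominus>\<^bsub>Qp p\<^esub> Qp_of_rat p (s n)) < e"
      using small[OF e] by metis
    have "padic_abs p (X n \<ominus>\<^bsub>Qp p\<^esub> Qp_class s) < e" if n: "n \<ge> max M N" for n
    proof -
      have "(\<lambda>m. padic_abs_rat p (s n - s m)) \<longlonglongrightarrow> padic_abs p (Qp_class (\<lambda>m. s n - s m))"
        by (intro padic_abs_class_tendsto padic_Cauchy_diff cs padic_Cauchy_const)
      hence "padic_abs p (Qp_class (\<lambda>m. s n - s m)) \<le> e / 2"
        by (rule LIMSEQ_le_const2) (use M n in \<open>auto intro!: exI[of _ M] less_imp_le\<close>)
      hence "padic_abs p (Qp_of_rat p (s n) \<ominus>\<^bsub>Qp p\<^esub> Qp_class s) < e"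
        using e by (simp add: Qp_class_simps cs)
      thus ?thesis
        using padic_abs_diff_triangle[of "X n" "Qp_of_rat p (s n)" "Qp_class s"] X N[of n] n cs by simp
    qed
    thus "\<exists>N. \<forall>n\<ge>N. norm (padic_abs p (X n \<ominus>\<^bsub>Qp p\<^esub> Qp_class s) - 0) < e"
      using X cs by (intro exI[of _ "max M N"]) simp
  qed
  thus ?thesis using cs by (intro that[of "Qp_class s"]) auto
qed

lemma Qp_tendsto_unique:
  assumes "Qp_tendsto p X x" "Qp_tendsto p X y" "\<And>n. X n \<in> carrier (Qp p)"
    "x \<in> carrier (Qp p)" "y \<in> carrier (Qp p)"
  shows "x = y"
proof -
  have lim: "(\<lambda>n. max (padic_abs p (X n \<ominus>\<^bsub>Qp p\<^esub> x)) (padic_abs p (X n \<ominus>\<^bsub>Qp p\<^esub> y))) \<longlonglongrightarrow> max 0 0"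
    using assms(1,2) unfolding Qp_tendsto_def by (rule tendsto_max)
  have "padic_abs p (x \<ominus>\<^bsub>Qp p\<^esub> y) \<le> max 0 0"
  proof (rule LIMSEQ_le_const[OF lim], intro exI allI impI)
    fix n
    show "padic_abs p (x \<ominus>\<^bsub>Qp p\<^esub> y)
        \<le> max (padic_abs p (X n \<ominus>\<^bsub>Qp p\<^esub> x)) (padic_abs p (X n \<ominus>\<^bsub>Qp p\<^esub> y))"
      using padic_abs_diff_triangle[of x "X n" y] padic_abs_diff_commute[of x "X n"] assms(3-5) by simp
  qed
  hence "padic_abs p (x \<ominus>\<^bsub>Qp p\<^esub> y) = 0" using assms by (simp add: antisym)
  thus ?thesis using assms(4,5) by (simp add: padic_abs_eq_0_iff Qp_diff_eq_0_iff)
qed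

section \<open>Truncations and digit expansions\<close>

text \<open>This characterises \<open>\<Sum>n<k. a\<^sub>n p\<^sup>n\<close>, the part of the p-adic expansion of \<open>x\<close> below index \<open>k\<close>, without
mentioning digits. For \<open>k = 0\<close> it is the fractional part.\<close>

definition is_truncation :: "(nat \<Rightarrow> rat) set \<Rightarrow> int \<Rightarrow> rat \<Rightarrow> bool" where
  "is_truncation x k r \<longleftrightarrow> r \<in> p_fractions \<and> 0 \<le> r \<and> r < of_nat p powi k \<and>
     padic_abs p (x \<ominus>\<^bsub>Qp p\<^esub> Qp_of_rat p r) \<le> real p powi (- k)"

lemma powi_pos [simp]: "real p powi k > 0" "(of_nat p :: rat) powi k > 0"
  by (simp_all add: zero_less_power_int)

lemma powi_Suc: "(of_nat p :: rat) powi (k + 1) = of_nat p * of_nat p powi k"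
  by (simp add: power_int_add)

lemma powi_antimono: "k \<le> l \<Longrightarrow> real p powi (- l) \<le> real p powi (- k)"
  using p_gt_1 by (intro power_int_increasing) auto

lemma is_truncation_unique:
  assumes x: "x \<in> carrier (Qp p)" and r: "is_truncation x k r" and s: "is_truncation x k s"
  shows "r = s"
proof (rule p_fraction_unique)
  have "padic_abs p (Qp_of_rat p r \<ominus>\<^bsub>Qp p\<^esub> Qp_of_rat p s) \<le> real p powi (- k)"
    by (rule padic_abs_diff_le_common[of _ x]) (use x r s in \<open>auto simp: is_truncation_def\<close>)
  thus "padic_abs_rat p (r - s) \<le> real p powi (- k)" by (simp flip: Qp_of_rat_diff)
qed (use r s in \<open>auto simp: is_truncation_def\<close>)

text \<open>For \<open>k = 0\<close> this is the fractional part of a rational number near \<open>x\<close>; the general case follows by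
scaling with \<open>p\<^sup>k\<close>.\<close>

lemma is_truncation_exists:
  assumes x: "x \<in> carrier (Qp p)"
  shows "\<exists>r. is_truncation x k r"
proof -
  obtain q where q: "padic_abs p (x \<ominus>\<^bsub>Qp p\<^esub> Qp_of_rat p q) < real p powi (- k)"
    using Qp_rat_approx[OF x powi_pos(1)] by blast
  obtain s where s: "s \<in> p_fractions" "0 \<le> s" "s < 1"
      "padic_abs_rat p (q / of_nat p powi k - s) \<le> 1"
    using p_fraction_approx by blast
  define r where "r = s * of_nat p powi k"
  have "q - r = (q / of_nat p powi k - s) * of_nat p powi k"
    by (simp add: r_def left_diff_distrib)
  hence "padic_abs_rat p (q - r) = padic_abs_rat p (q / of_nat p powi k - s) * real p powi (- k)"
    by (simp only: padic_abs_rat_mult padic_abs_rat_powi)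
  also have "\<dots> \<le> real p powi (- k)"
    using mult_right_mono[OF s(4), of "real p powi (- k)"] powi_pos(1)[of "-k"] by simp
  finally have "padic_abs p (Qp_of_rat p q \<ominus>\<^bsub>Qp p\<^esub> Qp_of_rat p r) \<le> real p powi (- k)"
    by (simp flip: Qp_of_rat_diff)
  hence "padic_abs p (x \<ominus>\<^bsub>Qp p\<^esub> Qp_of_rat p r) \<le> real p powi (- k)"
    using padic_abs_diff_triangle[of x "Qp_of_rat p q" "Qp_of_rat p r"] x q by simp
  moreover have "r \<in> p_fractions" unfolding r_def by (intro p_fractions_mult p_fractions_powi s)
  moreover have "0 \<le> r" "r < of_nat p powi k"
    using s(2) mult_strict_right_mono[OF s(3), of "of_nat p powi k"] powi_pos(2)[of k]
    by (simp_all add: r_def)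
  ultimately show ?thesis unfolding is_truncation_def by blast
qed

definition truncation :: "(nat \<Rightarrow> rat) set \<Rightarrow> int \<Rightarrow> rat" where
  "truncation x k = (THE r. is_truncation x k r)"

lemma truncation_eqI: "x \<in> carrier (Qp p) \<Longrightarrow> is_truncation x k r \<Longrightarrow> truncation x k = r"
  unfolding truncation_def using is_truncation_unique by blast

lemma is_truncation_truncation: "x \<in> carrier (Qp p) \<Longrightarrow> is_truncation x k (truncation x k)"
  using is_truncation_exists truncation_eqI by metis

lemma truncation_eq_0:
  assumes "x \<in> carrier (Qp p)" "padic_abs p x \<le> real p powi (- v)" "k \<le> v"
  shows "truncation x k = 0"
  using assms powi_antimono[of k v]
  by (intro truncation_eqI) (auto simp: is_truncation_def)

lemma padic_order_bound:
  assumes "x \<in> carrier (Qp p)"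
  obtains v where "v \<le> 0" "padic_abs p x \<le> real p powi (- v)"
proof -
  obtain n where "padic_abs p x < real p ^ n"
    using real_arch_pow[of "real p"] p_gt_1 by auto
  thus ?thesis by (intro that[of "- int n"]) auto
qed

lemma partial_sum_Suc:
  fixes f :: "int \<Rightarrow> rat"
  shows "(\<Sum>n\<in>{v..<v + int (Suc N)}. f n) = f (v + int N) + (\<Sum>n\<in>{v..<v + int N}. f n)"
proof -
  have "{v..<v + int (Suc N)} = insert (v + int N) {v..<v + int N}" by auto
  thus ?thesis by simp
qed

lemma telescope_int:
  fixes r :: "int \<Rightarrow> rat"
  shows "(\<Sum>n\<in>{v..<v + int N}. r (n + 1) - r n) = r (v + int N) - r v"
  by (induction N) (simp, simp only: partial_sum_Suc, simp add: algebra_simps)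

text \<open>When the terms are differences of consecutive truncations, the partial sums telescope to
truncations, which converge to \<open>x\<close>.\<close>

lemma is_padic_expansion_truncations:
  assumes x: "x \<in> carrier (Qp p)"
    and a: "\<And>k. a k < p" "\<And>k. of_nat (a k) * of_nat p powi k = truncation x (k + 1) - truncation x k"
  shows "is_padic_expansion p x a"
proof -
  obtain v where v: "padic_abs p x \<le> real p powi (- v)" using padic_order_bound[OF x] .
  have zero: "a n = 0" if "n < v" for n
    using that a(2)[of n] truncation_eq_0[OF x v, of n] truncation_eq_0[OF x v, of "n + 1"] by simp
  have sum: "(\<Sum>n\<in>{v..<v + int N}. of_nat (a n) * of_nat p powi n) = truncation x (v + int N)" for N
    unfolding a(2) telescope_int using truncation_eq_0[OF x v, of v] by simp
  have "(\<lambda>N. padic_abs p (Qp_of_rat p (truncation x (v + int N)) \<ominus>\<^bsub>Qp p\<^esub> x)) \<longlonglongrightarrow> 0"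
  proof (rule Lim_null_comparison)
    show "\<forall>\<^sub>F N in sequentially. norm (padic_abs p (Qp_of_rat p (truncation x (v + int N)) \<ominus>\<^bsub>Qp p\<^esub> x))
        \<le> real p powi (- v) * inverse (real p) ^ N"
    proof (rule always_eventually, rule allI)
      fix N
      have "real p powi (- (v + int N)) = real p powi (- v) * inverse (real p) ^ N"
        by (simp add: power_int_diff divide_inverse power_inverse)
      thus "norm (padic_abs p (Qp_of_rat p (truncation x (v + int N)) \<ominus>\<^bsub>Qp p\<^esub> x))
        \<le> real p powi (- v) * inverse (real p) ^ N"
        using is_truncation_truncation[OF x, of "v + int N"] x
        by (simp add: is_truncation_def padic_abs_diff_commute)
    qed
    have "(\<lambda>N. inverse (real p) ^ N) \<longlonglongrightarrow> 0"
      using p_gt_1 by (intro LIMSEQ_realpow_zero) (auto simp: inverse_less_1_iff)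
    thus "(\<lambda>N. real p powi (- v) * inverse (real p) ^ N) \<longlonglongrightarrow> 0"
      by (rule tendsto_mult_right_zero)
  qed
  thus ?thesis
    unfolding is_padic_expansion_def Qp_tendsto_def using a(1) zero sum
    by (intro conjI exI[of _ v]) auto
qed

text \<open>Two consecutive truncations differ by an element of \<open>\<int>[1/p]\<close> that is p-adically divisible by \<open>p\<^sup>k\<close>,
hence by an integer multiple of \<open>p\<^sup>k\<close>; the size of the truncations confines the multiplier to the
range of a digit.\<close>

lemma truncation_difference:
  assumes x: "x \<in> carrier (Qp p)"
  shows "\<exists>c<p. of_nat c * of_nat p powi k = truncation x (k + 1) - truncation x k"
proof -
  define r where "r = truncation x k"
  define s where "s = truncation x (k + 1)"
  have r: "is_truncation x k r" and s: "is_truncation x (k + 1) s"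
    unfolding r_def s_def by (intro is_truncation_truncation x)+
  define t where "t = (s - r) * of_nat p powi (- k)"
  have t: "s - r = t * of_nat p powi k" by (simp add: t_def power_int_minus)
  have "padic_abs p (Qp_of_rat p s \<ominus>\<^bsub>Qp p\<^esub> Qp_of_rat p r) \<le> real p powi (- k)"
    by (rule padic_abs_diff_le_common[of _ x])
       (use x r s powi_antimono[of k "k + 1"] in \<open>auto simp: is_truncation_def\<close>)
  hence "padic_abs_rat p (s - r) \<le> real p powi (- k)" by (simp flip: Qp_of_rat_diff)
  hence "padic_abs_rat p t \<le> real p powi (- k) * real p powi k"
    unfolding t_def padic_abs_rat_mult padic_abs_rat_powi by (simp add: mult_right_mono)
  hence "padic_abs_rat p t \<le> 1" by (simp add: power_int_minus)
  moreover have "t \<in> p_fractions"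
    unfolding t_def using r s
    by (intro p_fractions_mult p_fractions_diff p_fractions_powi) (auto simp: is_truncation_def)
  ultimately have "t \<in> \<int>" by (intro p_fractions_abs_le_1_imp_int)
  then obtain c where c: "t = of_int c" by (elim Ints_cases)
  have "- (of_nat p powi k) < t * of_nat p powi k" "t * of_nat p powi k < of_nat p * of_nat p powi k"
    using r s by (auto simp: is_truncation_def powi_Suc simp flip: t)
  hence "(- 1) * of_nat p powi k < t * of_nat p powi k" "t * of_nat p powi k < of_nat p * of_nat p powi k"
    by auto
  hence "- 1 < t" "t < of_nat p"
    using mult_right_less_imp_less[OF _ less_imp_le[OF powi_pos(2)]] by blast+
  hence "(of_int (- 1) :: rat) < of_int c" "(of_int c :: rat) < of_int (int p)"
    by (simp_all add: c)
  hence "- 1 < c" "c < int p" by (simp_all only: of_int_less_iff)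
  hence "nat c < p" "of_nat (nat c) = t" by (auto simp: c)
  thus ?thesis using t by (auto simp: r_def s_def intro!: exI[of _ "nat c"])
qed

text \<open>Conversely every expansion has the truncations as partial sums, because these sums have the
right size and are p-adically close to the limit. The digits are thereby determined by \<open>x\<close>, which
is the uniqueness of expansions.\<close>

lemma expansion_truncation:
  assumes x: "x \<in> carrier (Qp p)" and a: "is_padic_expansion p x a"
  shows "of_nat (a k) * of_nat p powi k = truncation x (k + 1) - truncation x k"
proof -
  have lt: "a n < p" for n using a by (simp add: is_padic_expansion_def)
  define S where "S v N = (\<Sum>n\<in>{v..<v + int N}. of_nat (a n) * (of_nat p :: rat) powi n)" for v N
  have S_0: "S v 0 = 0" for v by (simp add: S_def)
  have S_Suc: "S v (Suc N) = of_nat (a (v + int N)) * of_nat p powi (v + int N) + S v N" for v N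
    unfolding S_def by (rule partial_sum_Suc)
  obtain v where zero: "\<And>n. n < v \<Longrightarrow> a n = 0" and lim: "Qp_tendsto p (\<lambda>N. Qp_of_rat p (S v N)) x"
    using a unfolding is_padic_expansion_def S_def by blast
  (* the bound is the value of the sum when all digits are p - 1 *)
  have upper: "S v N \<le> of_nat p powi (v + int N) - of_nat p powi v" for N
  proof (induction N)
    case (Suc N)
    have "(of_nat (a (v + int N)) :: rat) \<le> of_nat p - 1"
      using lt[of "v + int N"] by (simp add: le_diff_eq flip: of_nat_Suc)
    hence "of_nat (a (v + int N)) * (of_nat p :: rat) powi (v + int N)
        \<le> (of_nat p - 1) * of_nat p powi (v + int N)"
      by (intro mult_right_mono) auto
    moreover have "of_nat p powi (v + int (Suc N)) = (of_nat p :: rat) * of_nat p powi (v + int N)"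
      using powi_Suc[of "v + int N"] by (simp add: algebra_simps)
    ultimately show ?case using Suc by (simp add: S_Suc algebra_simps)
  qed (simp add: S_0)
  have close: "padic_abs_rat p (S v M - S v N) \<le> real p powi (- (v + int N))" if "N \<le> M" for M N
    using that
  proof (induction M rule: dec_induct)
    case (step M)
    have "padic_abs_rat p (of_nat (a (v + int M)) * of_nat p powi (v + int M))
        \<le> 1 * real p powi (- (v + int M))"
      unfolding padic_abs_rat_mult padic_abs_rat_powi
      using padic_abs_rat_of_int_le_1[of "int (a (v + int M))"] by (intro mult_right_mono) auto
    also have "\<dots> \<le> real p powi (- (v + int N))"
      using powi_antimono[of "v + int N" "v + int M"] step by simp
    finally show ?case
      using step.IH padic_abs_rat_add_le[of "of_nat (a (v + int M)) * of_nat p powi (v + int M)"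
          "S v M - S v N"]
      by (simp add: S_Suc algebra_simps)
  qed simp
  have trunc: "truncation x (v + int N) = S v N" for N
  proof (rule truncation_eqI[OF x])
    obtain M where M: "padic_abs p (Qp_of_rat p (S v m) \<ominus>\<^bsub>Qp p\<^esub> x) < real p powi (- (v + int N))"
      if "m \<ge> M" for m
      using LIMSEQ_D[OF lim[unfolded Qp_tendsto_def] powi_pos(1)[of "- (v + int N)"]] x by auto
    define m where "m = max M N"
    have "padic_abs p (x \<ominus>\<^bsub>Qp p\<^esub> Qp_of_rat p (S v N)) \<le> real p powi (- (v + int N))"
      by (rule padic_abs_diff_le_common[of _ "Qp_of_rat p (S v m)"])
         (use x M[of m] close[of N m] in \<open>auto simp: m_def simp flip: Qp_of_rat_diff\<close>)
    moreover have "S v N \<in> p_fractions"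
      unfolding S_def
      using p_fractions_mult[OF p_fractions_of_int p_fractions_powi, of "int (a n)" n for n]
      by (intro p_fractions_sum) simp
    moreover have "S v N \<ge> 0" unfolding S_def by (intro sum_nonneg) simp
    moreover have "S v N < of_nat p powi (v + int N)"
      using upper[of N] powi_pos(2)[of v] by linarith
    ultimately show "is_truncation x (v + int N) (S v N)" by (simp add: is_truncation_def)
  qed
  show ?thesis
  proof (cases "k < v")
    case True
    have "is_truncation x v 0" using trunc[of 0] is_truncation_truncation[OF x, of v] by (simp add: S_0)
    hence "padic_abs p x \<le> real p powi (- v)" using x by (simp add: is_truncation_def)
    thus ?thesis using True zero truncation_eq_0[OF x, of v] by simp
  next
    case False
    then obtain N where N: "k = v + int N" by (metis zle_iff_zadd linorder_not_less)
    show ?thesis using trunc[of N] trunc[of "Suc N"] S_Suc[of v N] by (simp add: N algebra_simps)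
  qed
qed

lemma padic_expansion_unique:
  assumes "x \<in> carrier (Qp p)" "is_padic_expansion p x a" "is_padic_expansion p x b"
  shows "a = b"
proof
  fix k
  have "(of_nat (a k) :: rat) * of_nat p powi k = of_nat (b k) * of_nat p powi k"
    using expansion_truncation assms by metis
  thus "a k = b k" using powi_pos(2)[of k] by (simp del: powi_pos)
qed

lemma is_padic_expansion_digit:
  assumes x: "x \<in> carrier (Qp p)"
  shows "is_padic_expansion p x (padic_digit p x)"
proof -
  obtain a where "\<And>k. a k < p"
    "\<And>k. of_nat (a k) * of_nat p powi k = truncation x (k + 1) - truncation x k"
    using truncation_difference[OF x] by metis
  hence "is_padic_expansion p x a" by (rule is_padic_expansion_truncations[OF x])
  thus ?thesis
    unfolding padic_digit_def using padic_expansion_unique[OF x] by (metis the_equality)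
qed

lemmas padic_digit_truncation = expansion_truncation[OF _ is_padic_expansion_digit]

lemma padic_frac_eq_truncation:
  assumes x: "x \<in> carrier (Qp p)"
  shows "padic_frac p x = truncation x 0"
proof -
  obtain v where v: "v \<le> 0" "padic_abs p x \<le> real p powi (- v)" using padic_order_bound[OF x] .
  have zero: "padic_digit p x n = 0" if "n < v" for n
    using that padic_digit_truncation[OF x x, of n] truncation_eq_0[OF x v(2), of n]
      truncation_eq_0[OF x v(2), of "n + 1"] by simp
  have "padic_frac p x = (\<Sum>n\<in>{v..<v + int (nat (- v))}. of_nat (padic_digit p x n) * of_nat p powi n)"
    unfolding padic_frac_def
    by (rule sum.mono_neutral_left) (use zero v(1) in \<open>auto simp: not_less[symmetric]\<close>)
  also have "\<dots> = truncation x 0"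
    unfolding padic_digit_truncation[OF x x] telescope_int
    using truncation_eq_0[OF x v(2), of v] v(1) by simp
  finally show ?thesis .
qed

lemma Zp_iff: "x \<in> Zp p \<longleftrightarrow> x \<in> carrier (Qp p) \<and> padic_abs p x \<le> 1"
  by (simp add: Zp_def)

lemma padic_int_part_eq:
  assumes x: "x \<in> carrier (Qp p)"
  shows "padic_int_part p x = x \<ominus>\<^bsub>Qp p\<^esub> Qp_of_rat p (truncation x 0)"
proof -
  let ?y = "x \<ominus>\<^bsub>Qp p\<^esub> Qp_of_rat p (truncation x 0)"
  let ?S = "\<lambda>N. \<Sum>n<N. of_nat (padic_digit p x (int n)) * (of_nat p :: rat) ^ n"
  have S: "?S N = truncation x (int N) - truncation x 0" for N
  proof (induction N)
    case (Suc N)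
    thus ?case using padic_digit_truncation[OF x x, of "int N"] by (simp add: algebra_simps)
  qed simp
  have "Qp_of_rat p (?S N) \<ominus>\<^bsub>Qp p\<^esub> ?y = Qp_of_rat p (truncation x (int N)) \<ominus>\<^bsub>Qp p\<^esub> x" for N
    unfolding S using x by (elim Qp_cases) (simp add: Qp_class_simps)
  moreover have "(\<lambda>N. padic_abs p (Qp_of_rat p (truncation x (int N)) \<ominus>\<^bsub>Qp p\<^esub> x)) \<longlonglongrightarrow> 0"
  proof (rule Lim_null_comparison)
    show "\<forall>\<^sub>F N in sequentially. norm (padic_abs p (Qp_of_rat p (truncation x (int N)) \<ominus>\<^bsub>Qp p\<^esub> x))
        \<le> inverse (real p) ^ N"
      using is_truncation_truncation[OF x, of "int N" for N] x
      by (simp add: is_truncation_def padic_abs_diff_commute power_int_minus power_inverse)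
    show "(\<lambda>N. inverse (real p) ^ N) \<longlonglongrightarrow> 0"
      using p_gt_1 by (intro LIMSEQ_realpow_zero) (auto simp: inverse_less_1_iff)
  qed
  ultimately have lim: "Qp_tendsto p (\<lambda>N. Qp_of_rat p (?S N)) ?y"
    by (simp add: Qp_tendsto_def)
  have "?y \<in> Zp p"
    using is_truncation_truncation[OF x, of 0] x by (simp add: Zp_iff is_truncation_def)
  thus ?thesis
    unfolding padic_int_part_def using lim
    by (intro the_equality) (simp, rule Qp_tendsto_unique[OF _ lim], auto simp: Zp_iff)
qed

section \<open>The solenoid as a quotient group\<close>

lemma Zp_closed [simp, intro]:
  "\<zero>\<^bsub>Qp p\<^esub> \<in> Zp p"
  "x \<in> Zp p \<Longrightarrow> y \<in> Zp p \<Longrightarrow> x \<oplus>\<^bsub>Qp p\<^esub> y \<in> Zp p"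
  "x \<in> Zp p \<Longrightarrow> y \<in> Zp p \<Longrightarrow> x \<ominus>\<^bsub>Qp p\<^esub> y \<in> Zp p"
  "x \<in> Zp p \<Longrightarrow> \<ominus>\<^bsub>Qp p\<^esub> x \<in> Zp p"
  "Qp_of_rat p (of_int n) \<in> Zp p"
  using padic_abs_add_le[of x y] padic_abs_diff_le[of x y] padic_abs_rat_of_int_le_1
  by (auto simp: Zp_iff)

lemma Zp_carrier: "x \<in> Zp p \<Longrightarrow> x \<in> carrier (Qp p)"
  by (simp add: Zp_iff)

text \<open>The class of \<open>(t, x)\<close> in \<open>(\<real> \<times> \<int>\<^sub>p) / {(n, -n)}\<close>, given by its representative with first coordinate
in \<open>[0, 1)\<close>. On these points the group law is plain addition of representatives, without carries.\<close>

definition solenoid_point :: "real \<Rightarrow> (nat \<Rightarrow> rat) set \<Rightarrow> real \<times> (nat \<Rightarrow> rat) set" where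
  "solenoid_point t x = (frac t, x \<oplus>\<^bsub>Qp p\<^esub> Qp_of_rat p (of_int \<lfloor>t\<rfloor>))"

lemma Tp_simps:
  "carrier (Tp p) = {0..<1} \<times> Zp p"
  "\<one>\<^bsub>Tp p\<^esub> = (0, \<zero>\<^bsub>Qp p\<^esub>)"
  "(\<xi>, x) \<otimes>\<^bsub>Tp p\<^esub> (\<eta>, y) =
    (frac (\<xi> + \<eta>), x \<oplus>\<^bsub>Qp p\<^esub> y \<oplus>\<^bsub>Qp p\<^esub> Qp_of_rat p (of_int \<lfloor>\<xi> + \<eta>\<rfloor>))"
  by (simp_all add: Tp_def frac_def)

lemma solenoid_point_closed [simp]: "x \<in> Zp p \<Longrightarrow> solenoid_point t x \<in> carrier (Tp p)"
  by (simp add: solenoid_point_def Tp_simps frac_lt_1)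

lemma solenoid_point_id:
  assumes "0 \<le> t" "t < 1" "x \<in> Zp p"
  shows "solenoid_point t x = (t, x)"
proof -
  have "\<lfloor>t\<rfloor> = 0" using assms by linarith
  thus ?thesis using assms by (simp add: solenoid_point_def frac_def Zp_carrier)
qed

lemma Tp_cases:
  assumes "h \<in> carrier (Tp p)"
  obtains t x where "0 \<le> t" "t < 1" "x \<in> Zp p" "h = (t, x)" "h = solenoid_point t x"
  using assms by (auto simp: Tp_simps solenoid_point_id)

text \<open>The carry in the group law of the solenoid makes up for the failure of the floor function to be
additive.\<close>

lemma solenoid_point_mult:
  assumes "x \<in> Zp p" "y \<in> Zp p"
  shows "solenoid_point t x \<otimes>\<^bsub>Tp p\<^esub> solenoid_point s y = solenoid_point (t + s) (x \<oplus>\<^bsub>Qp p\<^esub> y)"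
proof -
  have fl: "\<lfloor>t\<rfloor> + \<lfloor>s\<rfloor> + \<lfloor>frac t + frac s\<rfloor> = \<lfloor>t + s\<rfloor>"
    unfolding frac_def by linarith
  hence "frac (frac t + frac s) = frac (t + s)"
    unfolding frac_def by linarith
  moreover have "x \<oplus>\<^bsub>Qp p\<^esub> Qp_of_rat p (of_int a) \<oplus>\<^bsub>Qp p\<^esub> (y \<oplus>\<^bsub>Qp p\<^esub> Qp_of_rat p (of_int b))
      \<oplus>\<^bsub>Qp p\<^esub> Qp_of_rat p (of_int c) = x \<oplus>\<^bsub>Qp p\<^esub> y \<oplus>\<^bsub>Qp p\<^esub> Qp_of_rat p (of_int (a + b + c))" for a b c
    using assms[THEN Zp_carrier] by (elim Qp_cases) (simp add: Qp_class_simps algebra_simps)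
  ultimately show ?thesis by (simp add: solenoid_point_def Tp_simps fl del: of_int_add)
qed

lemma Tp_one: "\<one>\<^bsub>Tp p\<^esub> = solenoid_point 0 \<zero>\<^bsub>Qp p\<^esub>"
  by (simp add: Tp_simps solenoid_point_def)

text \<open>The projection from \<open>\<real> \<times> \<int>\<^sub>p\<close> is surjective and respects the operations, so the group laws descend.\<close>

lemma Tp_group: "group (Tp p)"
proof (rule groupI)
  fix f g h assume "f \<in> carrier (Tp p)" "g \<in> carrier (Tp p)" "h \<in> carrier (Tp p)"
  then obtain t x s y r z where
    "x \<in> Zp p" "f = solenoid_point t x" "y \<in> Zp p" "g = solenoid_point s y"
    "z \<in> Zp p" "h = solenoid_point r z" by (metis Tp_cases)
  thus "f \<otimes>\<^bsub>Tp p\<^esub> g \<otimes>\<^bsub>Tp p\<^esub> h = f \<otimes>\<^bsub>Tp p\<^esub> (g \<otimes>\<^bsub>Tp p\<^esub> h)"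
    by (simp add: solenoid_point_mult Q.a_assoc Zp_carrier add.assoc)
next
  fix f g assume "f \<in> carrier (Tp p)" "g \<in> carrier (Tp p)"
  then obtain t x s y where
    "x \<in> Zp p" "f = solenoid_point t x" "y \<in> Zp p" "g = solenoid_point s y" by (metis Tp_cases)
  thus "f \<otimes>\<^bsub>Tp p\<^esub> g \<in> carrier (Tp p)" by (simp add: solenoid_point_mult)
next
  fix f assume "f \<in> carrier (Tp p)"
  then obtain t x where f: "x \<in> Zp p" "f = solenoid_point t x" by (metis Tp_cases)
  thus "\<one>\<^bsub>Tp p\<^esub> \<otimes>\<^bsub>Tp p\<^esub> f = f" by (simp add: Tp_one solenoid_point_mult Zp_carrier)
  show "\<exists>g\<in>carrier (Tp p). g \<otimes>\<^bsub>Tp p\<^esub> f = \<one>\<^bsub>Tp p\<^esub>"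
    using f by (intro bexI[of _ "solenoid_point (- t) (\<ominus>\<^bsub>Qp p\<^esub> x)"])
      (simp_all add: Tp_one solenoid_point_mult Zp_carrier Q.l_neg)
qed (simp add: Tp_one)

sublocale T: group "Tp p" by (rule Tp_group)

lemma solenoid_point_inv:
  "x \<in> Zp p \<Longrightarrow> inv\<^bsub>Tp p\<^esub> solenoid_point t x = solenoid_point (- t) (\<ominus>\<^bsub>Qp p\<^esub> x)"
  by (rule T.inv_equality) (simp_all add: Tp_one solenoid_point_mult Zp_carrier Q.l_neg)

lemma solenoid_point_diff:
  "x \<in> Zp p \<Longrightarrow> y \<in> Zp p \<Longrightarrow>
    solenoid_point t x \<otimes>\<^bsub>Tp p\<^esub> inv\<^bsub>Tp p\<^esub> solenoid_point s y = solenoid_point (t - s) (x \<ominus>\<^bsub>Qp p\<^esub> y)"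
  by (simp add: solenoid_point_inv solenoid_point_mult a_minus_def)

section \<open>The embedding of the p-adic numbers\<close>

lemma solenoid_map_eq_truncation:
  "x \<in> carrier (Qp p) \<Longrightarrow>
    solenoid_map p x = (of_rat (truncation x 0), x \<ominus>\<^bsub>Qp p\<^esub> Qp_of_rat p (truncation x 0))"
  by (simp add: solenoid_map_def padic_frac_eq_truncation padic_int_part_eq)

text \<open>Any \<open>r\<close> in \<open>\<int>[1/p]\<close> with \<open>x - r\<close> in \<open>\<int>\<^sub>p\<close> may take the place of the fractional part: two choices
differ by an integer, and \<open>(n, -n)\<close> represents zero. The freedom of choice is what makes the map
additive although fractional parts are not.\<close>

lemma solenoid_map_eq:
  assumes x: "x \<in> carrier (Qp p)" and r: "r \<in> p_fractions" "x \<ominus>\<^bsub>Qp p\<^esub> Qp_of_rat p r \<in> Zp p"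
  shows "solenoid_map p x = solenoid_point (of_rat r) (x \<ominus>\<^bsub>Qp p\<^esub> Qp_of_rat p r)"
proof -
  (* r - floor r is the fractional part of x *)
  have eq: "x \<ominus>\<^bsub>Qp p\<^esub> Qp_of_rat p (r - of_int \<lfloor>r\<rfloor>)
      = x \<ominus>\<^bsub>Qp p\<^esub> Qp_of_rat p r \<oplus>\<^bsub>Qp p\<^esub> Qp_of_rat p (of_int \<lfloor>r\<rfloor>)"
    using x by (elim Qp_cases) (simp add: Qp_class_simps algebra_simps)
  have "r - of_int \<lfloor>r\<rfloor> \<in> p_fractions" "0 \<le> r - of_int \<lfloor>r\<rfloor>" "r - of_int \<lfloor>r\<rfloor> < 1"
    using r by (auto intro: p_fractions_diff) linarith
  moreover have "x \<ominus>\<^bsub>Qp p\<^esub> Qp_of_rat p (r - of_int \<lfloor>r\<rfloor>) \<in> Zp p"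
    unfolding eq using r by blast
  ultimately have "truncation x 0 = r - of_int \<lfloor>r\<rfloor>"
    by (intro truncation_eqI[OF x]) (auto simp: is_truncation_def Zp_iff)
  moreover have "\<lfloor>of_rat r :: real\<rfloor> = \<lfloor>r\<rfloor>"
    by (rule of_rat_floor)
  ultimately show ?thesis
    using x by (simp add: solenoid_map_eq_truncation eq solenoid_point_def frac_def of_rat_diff)
qed

lemma solenoid_lift:
  assumes "x \<in> carrier (Qp p)"
  obtains r where "r \<in> p_fractions" "x \<ominus>\<^bsub>Qp p\<^esub> Qp_of_rat p r \<in> Zp p"
  using is_truncation_truncation[OF assms, of 0] assms by (auto simp: is_truncation_def Zp_iff)

lemma solenoid_map_closed [simp]: "x \<in> carrier (Qp p) \<Longrightarrow> solenoid_map p x \<in> carrier (Tp p)"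
  by (metis solenoid_lift solenoid_map_eq solenoid_point_closed)

lemma solenoid_map_add:
  assumes "x \<in> carrier (Qp p)" "y \<in> carrier (Qp p)"
  shows "solenoid_map p (x \<oplus>\<^bsub>Qp p\<^esub> y) = solenoid_map p x \<otimes>\<^bsub>Tp p\<^esub> solenoid_map p y"
proof -
  obtain r s where r: "r \<in> p_fractions" "x \<ominus>\<^bsub>Qp p\<^esub> Qp_of_rat p r \<in> Zp p"
    and s: "s \<in> p_fractions" "y \<ominus>\<^bsub>Qp p\<^esub> Qp_of_rat p s \<in> Zp p" using assms by (metis solenoid_lift)
  have eq: "x \<oplus>\<^bsub>Qp p\<^esub> y \<ominus>\<^bsub>Qp p\<^esub> Qp_of_rat p (r + s)
      = (x \<ominus>\<^bsub>Qp p\<^esub> Qp_of_rat p r) \<oplus>\<^bsub>Qp p\<^esub> (y \<ominus>\<^bsub>Qp p\<^esub> Qp_of_rat p s)"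
    using assms by (elim Qp_cases) (simp add: Qp_class_simps algebra_simps)
  have "solenoid_map p (x \<oplus>\<^bsub>Qp p\<^esub> y)
      = solenoid_point (of_rat (r + s)) (x \<oplus>\<^bsub>Qp p\<^esub> y \<ominus>\<^bsub>Qp p\<^esub> Qp_of_rat p (r + s))"
    using assms r s by (intro solenoid_map_eq p_fractions_add) (auto simp: eq)
  thus ?thesis
    using r s by (simp add: eq of_rat_add solenoid_map_eq[OF assms(1) r] solenoid_map_eq[OF assms(2) s]
        solenoid_point_mult)
qed

lemma solenoid_map_group_hom: "group_hom (add_monoid (Qp p)) (Tp p) (solenoid_map p)"
  by (intro group_hom.intro group_hom_axioms.intro homI Q.a_group Tp_group)
     (auto simp: solenoid_map_add)

lemma solenoid_map_diff:
  assumes "x \<in> carrier (Qp p)" "y \<in> carrier (Qp p)"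
  shows "solenoid_map p x \<otimes>\<^bsub>Tp p\<^esub> inv\<^bsub>Tp p\<^esub> solenoid_map p y = solenoid_map p (x \<ominus>\<^bsub>Qp p\<^esub> y)"
proof -
  have "solenoid_map p (\<ominus>\<^bsub>Qp p\<^esub> y) = inv\<^bsub>Tp p\<^esub> solenoid_map p y"
    using group_hom.hom_inv[OF solenoid_map_group_hom, of y] assms(2) by (simp add: a_inv_def)
  moreover have "solenoid_map p (x \<ominus>\<^bsub>Qp p\<^esub> y) = solenoid_map p x \<otimes>\<^bsub>Tp p\<^esub> solenoid_map p (\<ominus>\<^bsub>Qp p\<^esub> y)"
    unfolding a_minus_def by (intro solenoid_map_add assms Q.a_inv_closed)
  ultimately show ?thesis by (simp only:)
qed

text \<open>A p-adic number is the sum of its fractional part and its integral part.\<close>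

lemma solenoid_map_inj: "inj_on (solenoid_map p) (carrier (Qp p))"
proof (rule inj_onI)
  fix x y assume x: "x \<in> carrier (Qp p)" and y: "y \<in> carrier (Qp p)"
    and eq: "solenoid_map p x = solenoid_map p y"
  have t: "truncation x 0 = truncation y 0" "x \<ominus>\<^bsub>Qp p\<^esub> Qp_of_rat p (truncation x 0)
      = y \<ominus>\<^bsub>Qp p\<^esub> Qp_of_rat p (truncation y 0)"
    using eq unfolding solenoid_map_eq_truncation[OF x] solenoid_map_eq_truncation[OF y] prod.inject
    unfolding of_rat_eq_iff by blast+
  have "z = (z \<ominus>\<^bsub>Qp p\<^esub> Qp_of_rat p r) \<oplus>\<^bsub>Qp p\<^esub> Qp_of_rat p r" if "z \<in> carrier (Qp p)" for z r
    using that by (elim Qp_cases) (simp add: Qp_class_simps)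
  thus "x = y" using t x y by metis
qed

lemma solenoid_map_Zp:
  assumes "x \<in> Zp p"
  shows "solenoid_map p x = solenoid_point 0 x"
  using solenoid_map_eq[of x 0] assms by (simp add: Zp_carrier)

section \<open>The metric as a quotient norm\<close>

text \<open>The quotient norm of \<open>max \<bar>t\<bar> (\<bar>x\<bar>\<^sub>p powr \<alpha>)\<close> on \<open>\<real> \<times> \<int>\<^sub>p\<close>. A point has at most two
representatives with \<open>\<bar>t\<bar> < 1\<close>, and up to sign their norms are the two lengths in the minimum.
It is a lower bound for all representatives (\<open>Tp_norm_point_le\<close>) and is attained by one of them
(\<open>Tp_norm_attained\<close>).\<close>

definition Tp_norm :: "real \<Rightarrow> real \<times> (nat \<Rightarrow> rat) set \<Rightarrow> real" where
  "Tp_norm \<alpha> h = min (Tp_length p \<alpha> h) (Tp_length p \<alpha> (inv\<^bsub>Tp p\<^esub> h))"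

lemma Tp_norm_inv: "h \<in> carrier (Tp p) \<Longrightarrow> Tp_norm \<alpha> (inv\<^bsub>Tp p\<^esub> h) = Tp_norm \<alpha> h"
  by (simp add: Tp_norm_def min.commute)

lemma Tp_dist_eq_norm:
  "f \<in> carrier (Tp p) \<Longrightarrow> g \<in> carrier (Tp p) \<Longrightarrow> Tp_dist p \<alpha> f g = Tp_norm \<alpha> (f \<otimes>\<^bsub>Tp p\<^esub> inv\<^bsub>Tp p\<^esub> g)"
  by (simp add: Tp_dist_def Tp_norm_def T.inv_mult_group)

lemma Tp_length_pair: "Tp_length p \<alpha> (t, x) = max t (padic_abs p x powr \<alpha>)"
  by (simp add: Tp_length_def)

lemma padic_abs_powr_le_1:
  "\<alpha> > 0 \<Longrightarrow> x \<in> Zp p \<Longrightarrow> padic_abs p x powr \<alpha> \<le> 1"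
  by (simp add: Zp_iff powr_le1)

lemma Tp_length_le_1:
  assumes "\<alpha> > 0" "h \<in> carrier (Tp p)" shows "Tp_length p \<alpha> h \<le> 1"
  using assms(2) by (elim Tp_cases) (simp add: Tp_length_pair padic_abs_powr_le_1 assms(1))

text \<open>Representatives with \<open>\<bar>t\<bar> \<ge> 1\<close> are harmless, because no length exceeds 1.\<close>

lemma Tp_norm_point_le:
  assumes "\<alpha> > 0" "x \<in> Zp p"
  shows "Tp_norm \<alpha> (solenoid_point t x) \<le> max \<bar>t\<bar> (padic_abs p x powr \<alpha>)"
proof -
  consider "\<bar>t\<bar> \<ge> 1" | "0 \<le> t" "t < 1" | "0 \<le> - t" "- t < 1" by linarith
  thus ?thesis
  proof cases
    case 1
    thus ?thesis using Tp_length_le_1[OF assms(1), of "solenoid_point t x"] assms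
      by (simp add: Tp_norm_def min_def max_def)
  next
    case 2
    thus ?thesis using assms by (simp add: Tp_norm_def solenoid_point_id Tp_length_pair)
  next
    case 3
    thus ?thesis
      using solenoid_point_id[OF 3, of "\<ominus>\<^bsub>Qp p\<^esub> x"] assms
      by (simp add: Tp_norm_def solenoid_point_inv Tp_length_pair Zp_carrier)
  qed
qed

lemma Tp_norm_point_0:
  assumes "x \<in> Zp p"
  shows "Tp_norm \<alpha> (solenoid_point 0 x) = padic_abs p x powr \<alpha>"
proof -
  have "solenoid_point 0 x = (0, x)" "inv\<^bsub>Tp p\<^esub> solenoid_point 0 x = (0, \<ominus>\<^bsub>Qp p\<^esub> x)"
    using assms solenoid_point_inv[OF assms, of 0] by (simp_all only: minus_zero) (simp_all add: solenoid_point_id)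
  thus ?thesis using assms by (simp add: Tp_norm_def Tp_length_pair Zp_carrier)
qed

lemma Tp_norm_attained:
  assumes "h \<in> carrier (Tp p)"
  obtains t x where "x \<in> Zp p" "h = solenoid_point t x" "Tp_norm \<alpha> h = max \<bar>t\<bar> (padic_abs p x powr \<alpha>)"
proof (cases "Tp_length p \<alpha> h \<le> Tp_length p \<alpha> (inv\<^bsub>Tp p\<^esub> h)")
  case True
  obtain t x where tx: "0 \<le> t" "t < 1" "x \<in> Zp p" "h = (t, x)" "h = solenoid_point t x"
    using assms by (rule Tp_cases)
  have "Tp_norm \<alpha> h = Tp_length p \<alpha> (t, x)" using True by (simp add: Tp_norm_def flip: tx(4))
  thus ?thesis using tx by (intro that[of x t]) (auto simp: Tp_length_pair)
next
  case False
  obtain t x where tx: "0 \<le> t" "t < 1" "x \<in> Zp p" "inv\<^bsub>Tp p\<^esub> h = (t, x)"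
      "inv\<^bsub>Tp p\<^esub> h = solenoid_point t x"
    using Tp_cases[of "inv\<^bsub>Tp p\<^esub> h"] assms by auto
  have "h = inv\<^bsub>Tp p\<^esub> solenoid_point t x" using assms by (simp flip: tx(5))
  hence "h = solenoid_point (- t) (\<ominus>\<^bsub>Qp p\<^esub> x)" using tx(3) by (simp add: solenoid_point_inv)
  moreover have "Tp_norm \<alpha> h = Tp_length p \<alpha> (t, x)" using False by (simp add: Tp_norm_def flip: tx(4))
  ultimately show ?thesis using tx by (intro that[of "\<ominus>\<^bsub>Qp p\<^esub> x" "- t"]) (auto simp: Tp_length_pair Zp_carrier)
qed

text \<open>Monotone functions preserve ultrametric inequalities, which is why every positive
exponent gives a metric.\<close>

lemma padic_abs_powr_add_le:
  assumes "\<alpha> > 0" "x \<in> carrier (Qp p)" "y \<in> carrier (Qp p)"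
  shows "padic_abs p (x \<oplus>\<^bsub>Qp p\<^esub> y) powr \<alpha> \<le> max (padic_abs p x powr \<alpha>) (padic_abs p y powr \<alpha>)"
proof -
  have "padic_abs p (x \<oplus>\<^bsub>Qp p\<^esub> y) \<le> padic_abs p x \<or> padic_abs p (x \<oplus>\<^bsub>Qp p\<^esub> y) \<le> padic_abs p y"
    using padic_abs_add_le[OF assms(2,3)] by linarith
  thus ?thesis using assms by (auto simp: le_max_iff_disj intro: powr_mono2)
qed

text \<open>Subadditivity of a quotient norm: add representatives that attain the two norms.\<close>

lemma Tp_norm_mult_le:
  assumes "\<alpha> > 0" "g \<in> carrier (Tp p)" "h \<in> carrier (Tp p)"
  shows "Tp_norm \<alpha> (g \<otimes>\<^bsub>Tp p\<^esub> h) \<le> Tp_norm \<alpha> g + Tp_norm \<alpha> h"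
proof -
  obtain t x where g: "x \<in> Zp p" "g = solenoid_point t x" "Tp_norm \<alpha> g = max \<bar>t\<bar> (padic_abs p x powr \<alpha>)"
    using assms(2) by (rule Tp_norm_attained)
  obtain s y where h: "y \<in> Zp p" "h = solenoid_point s y" "Tp_norm \<alpha> h = max \<bar>s\<bar> (padic_abs p y powr \<alpha>)"
    using assms(3) by (rule Tp_norm_attained)
  have "Tp_norm \<alpha> (g \<otimes>\<^bsub>Tp p\<^esub> h) \<le> max \<bar>t + s\<bar> (padic_abs p (x \<oplus>\<^bsub>Qp p\<^esub> y) powr \<alpha>)"
    using g h assms(1) by (simp add: solenoid_point_mult Tp_norm_point_le Zp_closed(2))
  also have "\<dots> \<le> max \<bar>t\<bar> (padic_abs p x powr \<alpha>) + max \<bar>s\<bar> (padic_abs p y powr \<alpha>)"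
  proof (rule max.boundedI)
    show "\<bar>t + s\<bar> \<le> max \<bar>t\<bar> (padic_abs p x powr \<alpha>) + max \<bar>s\<bar> (padic_abs p y powr \<alpha>)"
      by (rule order_trans[OF abs_triangle_ineq add_mono]) simp_all
    have "padic_abs p (x \<oplus>\<^bsub>Qp p\<^esub> y) powr \<alpha> \<le> max (padic_abs p x powr \<alpha>) (padic_abs p y powr \<alpha>)"
      using g(1) h(1) by (intro padic_abs_powr_add_le assms(1) Zp_carrier)
    also have "\<dots> \<le> padic_abs p x powr \<alpha> + padic_abs p y powr \<alpha>" by simp
    also have "\<dots> \<le> max \<bar>t\<bar> (padic_abs p x powr \<alpha>) + max \<bar>s\<bar> (padic_abs p y powr \<alpha>)"
      by (rule add_mono) simp_all
    finally show "padic_abs p (x \<oplus>\<^bsub>Qp p\<^esub> y) powr \<alpha>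
        \<le> max \<bar>t\<bar> (padic_abs p x powr \<alpha>) + max \<bar>s\<bar> (padic_abs p y powr \<alpha>)" .
  qed
  finally show ?thesis using g h by simp
qed

lemma Tp_norm_eq_0_iff:
  assumes "h \<in> carrier (Tp p)"
  shows "Tp_norm \<alpha> h = 0 \<longleftrightarrow> h = \<one>\<^bsub>Tp p\<^esub>"
proof
  assume *: "Tp_norm \<alpha> h = 0"
  obtain t x where tx: "x \<in> Zp p" "h = solenoid_point t x" "Tp_norm \<alpha> h = max \<bar>t\<bar> (padic_abs p x powr \<alpha>)"
    using assms by (rule Tp_norm_attained)
  have "\<bar>t\<bar> \<le> Tp_norm \<alpha> h" "padic_abs p x powr \<alpha> \<le> Tp_norm \<alpha> h" by (simp_all add: tx(3))
  hence "t = 0" "padic_abs p x powr \<alpha> = 0" by (simp_all add: *)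
  thus "h = \<one>\<^bsub>Tp p\<^esub>" using tx by (simp add: padic_abs_eq_0_iff Zp_carrier Tp_one)
next
  assume "h = \<one>\<^bsub>Tp p\<^esub>"
  thus "Tp_norm \<alpha> h = 0" by (simp add: Tp_norm_def Tp_simps(2)[THEN arg_cong, of "Tp_length p \<alpha>"] Tp_length_pair)
qed

lemma Tp_dist_point_le:
  assumes "\<alpha> > 0" "x \<in> Zp p" "y \<in> Zp p"
  shows "Tp_dist p \<alpha> (solenoid_point t x) (solenoid_point s y)
    \<le> max \<bar>t - s\<bar> (padic_abs p (x \<ominus>\<^bsub>Qp p\<^esub> y) powr \<alpha>)"
  using Tp_norm_point_le[OF assms(1), of "x \<ominus>\<^bsub>Qp p\<^esub> y" "t - s"] assms
  by (simp add: Tp_dist_eq_norm solenoid_point_diff Zp_closed(3))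

lemma Tp_Metric_space:
  assumes "\<alpha> > 0"
  shows "Metric_space (carrier (Tp p)) (Tp_dist p \<alpha>)"
proof
  fix f g
  show "Tp_dist p \<alpha> f g \<ge> 0"
    by (auto simp: Tp_dist_def Tp_length_def le_max_iff_disj split: prod.splits)
  show "Tp_dist p \<alpha> f g = Tp_dist p \<alpha> g f"
    by (simp add: Tp_dist_def min.commute)
next
  fix f g assume f: "f \<in> carrier (Tp p)" and g: "g \<in> carrier (Tp p)"
  show "Tp_dist p \<alpha> f g = 0 \<longleftrightarrow> f = g"
    using f g by (simp add: Tp_dist_eq_norm Tp_norm_eq_0_iff) (metis T.inv_closed T.inv_equality T.inv_inv T.r_inv)
  fix h assume h: "h \<in> carrier (Tp p)"
  have "f \<otimes>\<^bsub>Tp p\<^esub> inv\<^bsub>Tp p\<^esub> h = (f \<otimes>\<^bsub>Tp p\<^esub> inv\<^bsub>Tp p\<^esub> g) \<otimes>\<^bsub>Tp p\<^esub> (g \<otimes>\<^bsub>Tp p\<^esub> inv\<^bsub>Tp p\<^esub> h)"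
    using f g h by (simp add: T.m_assoc T.inv_solve_left flip: T.m_assoc[of "inv\<^bsub>Tp p\<^esub> g"])
  thus "Tp_dist p \<alpha> f h \<le> Tp_dist p \<alpha> f g + Tp_dist p \<alpha> g h"
    using f g h Tp_norm_mult_le[OF assms, of "f \<otimes>\<^bsub>Tp p\<^esub> inv\<^bsub>Tp p\<^esub> g" "g \<otimes>\<^bsub>Tp p\<^esub> inv\<^bsub>Tp p\<^esub> h"]
    by (simp add: Tp_dist_eq_norm)
qed

lemma Qp_Metric_space:
  assumes "\<alpha> > 0"
  shows "Metric_space (carrier (Qp p)) (Qp_dist p \<alpha>)"
proof
  fix x y
  show "Qp_dist p \<alpha> x y \<ge> 0" by (simp add: Qp_dist_def)
  show "Qp_dist p \<alpha> x y = Qp_dist p \<alpha> y x"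
    by (simp add: Qp_dist_def padic_abs_diff_commute)
next
  fix x y assume x: "x \<in> carrier (Qp p)" and y: "y \<in> carrier (Qp p)"
  show "Qp_dist p \<alpha> x y = 0 \<longleftrightarrow> x = y"
    using x y by (simp add: Qp_dist_def padic_abs_eq_0_iff Qp_diff_eq_0_iff)
  fix z assume z: "z \<in> carrier (Qp p)"
  show "Qp_dist p \<alpha> x z \<le> Qp_dist p \<alpha> x y + Qp_dist p \<alpha> y z"
  proof -
    have "padic_abs p (x \<ominus>\<^bsub>Qp p\<^esub> z) powr \<alpha>
        \<le> max (padic_abs p (x \<ominus>\<^bsub>Qp p\<^esub> y) powr \<alpha>) (padic_abs p (y \<ominus>\<^bsub>Qp p\<^esub> z) powr \<alpha>)"
      using padic_abs_powr_add_le[OF assms, of "x \<ominus>\<^bsub>Qp p\<^esub> y" "y \<ominus>\<^bsub>Qp p\<^esub> z"] x y z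
      by (simp add: Qp_diff_add_diff)
    also have "\<dots> \<le> padic_abs p (x \<ominus>\<^bsub>Qp p\<^esub> y) powr \<alpha> + padic_abs p (y \<ominus>\<^bsub>Qp p\<^esub> z) powr \<alpha>"
      by simp
    finally show ?thesis using x y z by (simp add: Qp_dist_def)
  qed
qed

text \<open>On a ball of radius 1 all differences are p-adic integers. Their images have real coordinate 0, and
there the norm of the solenoid is just the power of the p-adic absolute value.\<close>

lemma solenoid_map_local_isometry:
  assumes "\<alpha> > 0"
  shows "local_isometry (carrier (Qp p)) (Qp_dist p \<alpha>) (carrier (Tp p)) (Tp_dist p \<alpha>) (solenoid_map p)"
proof -
  interpret MQ: Metric_space "carrier (Qp p)" "Qp_dist p \<alpha>" by (rule Qp_Metric_space[OF assms])
  have "Tp_dist p \<alpha> (solenoid_map p y) (solenoid_map p z) = Qp_dist p \<alpha> y z"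
    if x: "x \<in> carrier (Qp p)" and y: "y \<in> MQ.mball x 1" and z: "z \<in> MQ.mball x 1" for x y z
  proof -
    have le: "padic_abs p (x \<ominus>\<^bsub>Qp p\<^esub> w) \<le> 1" if "w \<in> MQ.mball x 1" for w
    proof (rule ccontr)
      assume "\<not> ?thesis"
      hence "padic_abs p (x \<ominus>\<^bsub>Qp p\<^esub> w) powr \<alpha> \<ge> 1"
        using assms by (intro ge_one_powr_ge_zero) auto
      thus False using that by (auto simp: Qp_dist_def)
    qed
    have yz: "y \<in> carrier (Qp p)" "z \<in> carrier (Qp p)" using y z by auto
    have Z: "y \<ominus>\<^bsub>Qp p\<^esub> z \<in> Zp p"
      using padic_abs_diff_le_common[OF yz(1) x yz(2) le[OF y] le[OF z]] yz by (simp add: Zp_iff)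
    have "Tp_dist p \<alpha> (solenoid_map p y) (solenoid_map p z) = Tp_norm \<alpha> (solenoid_point 0 (y \<ominus>\<^bsub>Qp p\<^esub> z))"
      using yz Z by (simp add: Tp_dist_eq_norm solenoid_map_diff solenoid_map_Zp)
    also have "\<dots> = padic_abs p (y \<ominus>\<^bsub>Qp p\<^esub> z) powr \<alpha>"
      using Z by (rule Tp_norm_point_0)
    finally show ?thesis using yz by (simp add: Qp_dist_def)
  qed
  thus ?thesis
    unfolding local_isometry_def
    by (auto simp: Tp_Metric_space Qp_Metric_space assms intro!: exI[of _ "MQ.mball _ 1"])
qed

section \<open>Density of the rationals\<close>

text \<open>The rational numbers \<open>r + y\<close> with \<open>r\<close> in \<open>\<int>[1/p]\<close> and \<open>y\<close> in \<open>\<int>\<^sub>p\<close> are mapped to the points \<open>(r, y)\<close>.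
Here \<open>r\<close> and \<open>y\<close> can be chosen independently, and both approximate arbitrarily well.\<close>

lemma solenoid_rat_dense:
  assumes "\<alpha> > 0" "h \<in> carrier (Tp p)" "e > 0"
  obtains q where "Tp_dist p \<alpha> h (solenoid_map p (Qp_of_rat p q)) < e"
proof -
  obtain t x where tx: "x \<in> Zp p" "h = solenoid_point t x" using assms(2) by (rule Tp_cases)
  (* t is rounded down to a multiple of 1 / p^n *)
  obtain n where n: "inverse (real p) ^ n < e"
    using real_arch_pow_inv[OF assms(3), of "inverse (real p)"] p_gt_1 by (auto simp: inverse_less_1_iff)
  define r :: rat where "r = of_int \<lfloor>t * real p ^ n\<rfloor> / of_nat p ^ n"
  have r: "r \<in> p_fractions" unfolding r_def p_fractions_def by blast
  have "\<bar>t - of_rat r\<bar> * real p ^ n < 1"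
  proof -
    have "\<bar>t - of_rat r\<bar> * real p ^ n = \<bar>(t - of_rat r) * real p ^ n\<bar>" by (simp add: abs_mult)
    also have "(t - of_rat r) * real p ^ n = frac (t * real p ^ n)"
      by (simp add: r_def of_rat_divide of_rat_power left_diff_distrib frac_def)
    finally show ?thesis by (simp add: frac_lt_1)
  qed
  hence "\<bar>t - of_rat r\<bar> < 1 / real p ^ n" by (simp only: pos_less_divide_eq zero_less_power of_nat_0_less_iff p_pos)
  hence t: "\<bar>t - of_rat r\<bar> < e" using n by (simp add: inverse_eq_divide power_one_over)
  (* the bound 1 keeps y in the ring of p-adic integers; the other one becomes e after raising to the power alpha *)
  obtain y where y: "padic_abs p (x \<ominus>\<^bsub>Qp p\<^esub> Qp_of_rat p y) < min 1 (e powr (1 / \<alpha>))"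
    using Qp_rat_approx[of x "min 1 (e powr (1 / \<alpha>))"] tx(1) assms by (auto simp: Zp_carrier)
  have "padic_abs p (x \<ominus>\<^bsub>Qp p\<^esub> Qp_of_rat p y) powr \<alpha> < (e powr (1 / \<alpha>)) powr \<alpha>"
    using y tx(1) assms by (intro powr_less_mono2) (auto simp: Zp_carrier)
  hence ye: "padic_abs p (x \<ominus>\<^bsub>Qp p\<^esub> Qp_of_rat p y) powr \<alpha> < e"
    using assms by (simp add: powr_powr)
  have yZ: "Qp_of_rat p y \<in> Zp p"
    using padic_abs_diff_le_common[of "Qp_of_rat p y" x "\<zero>\<^bsub>Qp p\<^esub>" 1] y tx(1) by (simp add: Zp_iff)
  have "Qp_of_rat p (r + y) \<ominus>\<^bsub>Qp p\<^esub> Qp_of_rat p r = Qp_of_rat p y"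
    by (simp flip: Qp_of_rat_diff)
  hence "solenoid_map p (Qp_of_rat p (r + y)) = solenoid_point (of_rat r) (Qp_of_rat p y)"
    using solenoid_map_eq[of "Qp_of_rat p (r + y)" r] r yZ by simp
  hence "Tp_dist p \<alpha> h (solenoid_map p (Qp_of_rat p (r + y)))
      \<le> max \<bar>t - of_rat r\<bar> (padic_abs p (x \<ominus>\<^bsub>Qp p\<^esub> Qp_of_rat p y) powr \<alpha>)"
    using Tp_dist_point_le[OF assms(1) tx(1) yZ] tx(2) by simp
  also have "\<dots> < e" using t ye by simp
  finally show ?thesis by (rule that)
qed

lemma solenoid_rat_closure:
  assumes "\<alpha> > 0"
  shows "Metric_space.mtopology (carrier (Tp p)) (Tp_dist p \<alpha>)
    closure_of (solenoid_map p ` range (Qp_of_rat p)) = carrier (Tp p)"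
proof -
  interpret M: Metric_space "carrier (Tp p)" "Tp_dist p \<alpha>" by (rule Tp_Metric_space[OF assms])
  show ?thesis
  proof (intro equalityI subsetI)
    fix h assume h: "h \<in> carrier (Tp p)"
    have "\<exists>g\<in>solenoid_map p ` range (Qp_of_rat p). g \<in> M.mball h e" if e: "e > 0" for e
    proof -
      obtain q where "Tp_dist p \<alpha> h (solenoid_map p (Qp_of_rat p q)) < e"
        using solenoid_rat_dense[OF assms h e] .
      thus ?thesis using h by (intro bexI[of _ "solenoid_map p (Qp_of_rat p q)"]) simp_all
    qed
    thus "h \<in> M.mtopology closure_of (solenoid_map p ` range (Qp_of_rat p))"
      unfolding M.metric_closure_of using h by blast
  qed (simp add: M.metric_closure_of)
qed

section \<open>Completeness of the solenoid\<close>

text \<open>For small \<open>t\<close> the competing representative has real coordinate at distance more than \<open>1/2\<close> from 0,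
so it cannot realise a small norm. Closeness in the solenoid then forces p-adic closeness.\<close>

lemma Tp_norm_point_ge:
  assumes "x \<in> Zp p" "\<bar>t\<bar> < 1 / 2" "Tp_norm \<alpha> (solenoid_point t x) < 1 / 2"
  shows "padic_abs p x powr \<alpha> \<le> Tp_norm \<alpha> (solenoid_point t x)"
proof -
  have pos: "padic_abs p x powr \<alpha> \<le> Tp_norm \<alpha> (solenoid_point t x)"
    if x: "x \<in> Zp p" and t: "0 \<le> t" "t < 1 / 2" and small: "Tp_norm \<alpha> (solenoid_point t x) < 1 / 2" for t x
  proof (cases "t = 0")
    case True
    thus ?thesis using x by (simp add: Tp_norm_point_0)
  next
    case False
    have "Tp_length p \<alpha> (inv\<^bsub>Tp p\<^esub> solenoid_point t x) \<ge> frac (- t)"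
      unfolding solenoid_point_inv[OF x] by (simp add: solenoid_point_def Tp_length_pair)
    moreover have "\<lfloor>- t\<rfloor> = - 1" using t False by linarith
    hence "frac (- t) = 1 - t" by (simp add: frac_def)
    ultimately have "Tp_norm \<alpha> (solenoid_point t x) = Tp_length p \<alpha> (solenoid_point t x)"
      using small t by (simp add: Tp_norm_def)
    thus ?thesis using x t by (simp add: solenoid_point_id Tp_length_pair)
  qed
  show ?thesis
  proof (cases "t \<ge> 0")
    case True
    thus ?thesis using pos assms by simp
  next
    case False
    have "Tp_norm \<alpha> (solenoid_point (- t) (\<ominus>\<^bsub>Qp p\<^esub> x)) = Tp_norm \<alpha> (solenoid_point t x)"
      using Tp_norm_inv[of "solenoid_point t x" \<alpha>] assms(1) by (simp add: solenoid_point_inv)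
    thus ?thesis using pos[of "\<ominus>\<^bsub>Qp p\<^esub> x" "- t"] assms False by (simp add: Zp_carrier)
  qed
qed

text \<open>By compactness of \<open>[0, 1]\<close> a subsequence has convergent real coordinates \<open>t n\<close>. Along it the metric
controls the p-adic coordinates \<open>X n\<close>, which converge in \<open>\<int>\<^sub>p\<close>. The point of the two limits is
also meaningful when the real limit is 1, since points of the solenoid are classes. A
Cauchy sequence with a convergent subsequence converges.\<close>

lemma Tp_complete:
  assumes \<alpha>: "\<alpha> > 0"
  shows "Metric_space.mcomplete (carrier (Tp p)) (Tp_dist p \<alpha>)"
proof -
  interpret M: Metric_space "carrier (Tp p)" "Tp_dist p \<alpha>" by (rule Tp_Metric_space[OF assms])
  have "\<exists>h. limitin M.mtopology \<sigma> h sequentially" if \<sigma>: "M.MCauchy \<sigma>" for \<sigma>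
  proof -
    have "\<sigma> n \<in> carrier (Tp p)" for n using \<sigma> by (auto simp: M.MCauchy_def)
    hence fst: "fst (\<sigma> n) \<in> {0..1}" and snd: "snd (\<sigma> n) \<in> Zp p"
      and \<sigma>_eq: "\<sigma> n = solenoid_point (fst (\<sigma> n)) (snd (\<sigma> n))" for n
      by (metis Tp_cases fst_conv snd_conv atLeastAtMost_iff less_imp_le)+
    obtain \<xi> r where r: "strict_mono r" and \<xi>: "(\<lambda>n. fst (\<sigma> (r n))) \<longlonglongrightarrow> \<xi>"
      using compact_Icc[of 0 "1::real"] fst unfolding compact_def
      by (elim allE[of _ "\<lambda>n. fst (\<sigma> n)"]) (auto simp: o_def)
    define t where "t n = fst (\<sigma> (r n))" for n
    define X where "X n = snd (\<sigma> (r n))" for n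
    have X: "X n \<in> Zp p" for n by (simp add: X_def snd)
    have \<sigma>r: "\<sigma> (r n) = solenoid_point (t n) (X n)" for n unfolding t_def X_def by (rule \<sigma>_eq)
    have "\<exists>M. \<forall>m\<ge>M. \<forall>n\<ge>M. padic_abs p (X m \<ominus>\<^bsub>Qp p\<^esub> X n) < e" if e: "e > 0" for e
    proof -
      have "Cauchy t" using \<xi> unfolding t_def by (intro convergent_Cauchy convergentI)
      (* 1/2 is the range in which the norm bounds the p-adic coordinate *)
      then obtain M1 where M1: "\<And>m n. m \<ge> M1 \<Longrightarrow> n \<ge> M1 \<Longrightarrow> \<bar>t m - t n\<bar> < 1 / 2"
        unfolding Cauchy_def dist_real_def by (metis half_gt_zero zero_less_one)
      obtain M2 where M2: "\<And>m n. m \<ge> M2 \<Longrightarrow> n \<ge> M2 \<Longrightarrow> Tp_dist p \<alpha> (\<sigma> m) (\<sigma> n) < min (1 / 2) (e powr \<alpha>)"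
        using \<sigma> e unfolding M.MCauchy_def by (elim conjE allE[of _ "min (1 / 2) (e powr \<alpha>)"]) auto
      have "padic_abs p (X m \<ominus>\<^bsub>Qp p\<^esub> X n) < e" if "m \<ge> max M1 M2" "n \<ge> max M1 M2" for m n
      proof (rule ccontr)
        assume "\<not> ?thesis"
        hence "e powr \<alpha> \<le> padic_abs p (X m \<ominus>\<^bsub>Qp p\<^esub> X n) powr \<alpha>"
          using e \<alpha> by (intro powr_mono2) auto
        moreover have "r m \<ge> M2" "r n \<ge> M2" using that seq_suble[OF r] by (meson le_trans max.boundedE)+
        hence "Tp_norm \<alpha> (solenoid_point (t m - t n) (X m \<ominus>\<^bsub>Qp p\<^esub> X n)) < min (1 / 2) (e powr \<alpha>)"
          using M2[of "r m" "r n"] X by (simp add: \<sigma>r Tp_dist_eq_norm solenoid_point_diff)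
        moreover have "\<bar>t m - t n\<bar> < 1 / 2" using M1 that by simp
        ultimately show False
          using Tp_norm_point_ge[of "X m \<ominus>\<^bsub>Qp p\<^esub> X n" "t m - t n" \<alpha>] X by simp
      qed
      thus ?thesis by blast
    qed
    then obtain x where x: "x \<in> carrier (Qp p)" and lim: "(\<lambda>n. padic_abs p (X n \<ominus>\<^bsub>Qp p\<^esub> x)) \<longlonglongrightarrow> 0"
      using Qp_complete[of X] X Zp_carrier by blast
    have xZ: "x \<in> Zp p"
    proof -
      obtain n where n: "padic_abs p (X n \<ominus>\<^bsub>Qp p\<^esub> x) < 1"
        using LIMSEQ_D[OF lim zero_less_one] by (auto simp: abs_less_iff)
      show ?thesis
        using padic_abs_diff_le_common[of x "X n" "\<zero>\<^bsub>Qp p\<^esub>" 1] n x X[of n] by (simp add: Zp_iff)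
    qed
    have "limitin M.mtopology (\<sigma> \<circ> r) (solenoid_point \<xi> x) sequentially"
      unfolding M.limit_metric_sequentially
    proof (intro conjI allI impI)
      fix e :: real assume e: "e > 0"
      have "(\<lambda>n. max \<bar>t n - \<xi>\<bar> (padic_abs p (X n \<ominus>\<^bsub>Qp p\<^esub> x) powr \<alpha>)) \<longlonglongrightarrow> max \<bar>\<xi> - \<xi>\<bar> (0 powr \<alpha>)"
        using \<xi> lim \<alpha> x X unfolding t_def
        by (intro tendsto_max tendsto_intros tendsto_powr' ) (auto simp: Zp_carrier)
      hence "(\<lambda>n. max \<bar>t n - \<xi>\<bar> (padic_abs p (X n \<ominus>\<^bsub>Qp p\<^esub> x) powr \<alpha>)) \<longlonglongrightarrow> 0" by simp
      from LIMSEQ_D[OF this e] obtain N where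
        N: "\<And>n. n \<ge> N \<Longrightarrow> max \<bar>t n - \<xi>\<bar> (padic_abs p (X n \<ominus>\<^bsub>Qp p\<^esub> x) powr \<alpha>) < e" by force
      have "Tp_dist p \<alpha> (solenoid_point (t n) (X n)) (solenoid_point \<xi> x) < e" if "n \<ge> N" for n
        using Tp_dist_point_le[OF \<alpha> X xZ] N[OF that] by (rule le_less_trans)
      thus "\<exists>N. \<forall>n\<ge>N. (\<sigma> \<circ> r) n \<in> carrier (Tp p) \<and> Tp_dist p \<alpha> ((\<sigma> \<circ> r) n) (solenoid_point \<xi> x) < e"
        using X by (auto simp: \<sigma>r)
    qed (use xZ in simp)
    thus ?thesis using M.MCauchy_convergent_subsequence[OF \<sigma> r] by blast
  qed
  thus ?thesis by (simp add: M.mcomplete_def)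
qed

lemma solenoid_completion:
  assumes \<alpha>: "\<alpha> > 0"
  shows "is_completion UNIV
     (\<lambda>q r. Tp_dist p \<alpha> (solenoid_map p (Qp_of_rat p q)) (solenoid_map p (Qp_of_rat p r)))
     (carrier (Tp p)) (Tp_dist p \<alpha>) (\<lambda>q. solenoid_map p (Qp_of_rat p q))"
proof -
  interpret M: Metric_space "carrier (Tp p)" "Tp_dist p \<alpha>" by (rule Tp_Metric_space[OF \<alpha>])
  have inj: "q = r" if "solenoid_map p (Qp_of_rat p q) = solenoid_map p (Qp_of_rat p r)" for q r
  proof -
    have "Qp_of_rat p q = Qp_of_rat p r" using solenoid_map_inj that by (auto dest: inj_onD)
    hence "Qp_of_rat p (q - r) = \<zero>\<^bsub>Qp p\<^esub>" by (simp add: Qp_of_rat_diff Qp_diff_eq_0_iff)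
    hence "padic_abs_rat p (q - r) = 0" by (metis padic_abs_of_rat padic_abs_zero)
    thus ?thesis by simp
  qed
  have "Metric_space UNIV
     (\<lambda>q r. Tp_dist p \<alpha> (solenoid_map p (Qp_of_rat p q)) (solenoid_map p (Qp_of_rat p r)))"
    by unfold_locales (auto simp: M.commute M.triangle dest: inj)
  thus ?thesis
    using solenoid_rat_closure[OF \<alpha>] Tp_complete[OF \<alpha>] M.Metric_space_axioms
    by (simp add: is_completion_def image_image)
qed

end

section \<open>The solenoid as a completion of the rationals\<close>

theorem theorem5:
  fixes p :: nat
  assumes "prime p"
  shows "group_hom (add_monoid (Qp p)) (Tp p) (solenoid_map p)
    \<and> inj_on (solenoid_map p) (carrier (Qp p))
    \<and> (\<forall>\<alpha>>0. local_isometry (carrier (Qp p)) (Qp_dist p \<alpha>)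
               (carrier (Tp p)) (Tp_dist p \<alpha>) (solenoid_map p))
    \<and> solenoid_map p ` range (Qp_of_rat p) \<subseteq> solenoid_map p ` carrier (Qp p)
    \<and> (\<forall>\<alpha>>0. Metric_space.mtopology (carrier (Tp p)) (Tp_dist p \<alpha>)
               closure_of (solenoid_map p ` range (Qp_of_rat p)) = carrier (Tp p))
    \<and> (\<forall>\<alpha>>0. Metric_space.mcomplete (carrier (Tp p)) (Tp_dist p \<alpha>))
    \<and> (\<forall>\<alpha>>0. is_completion UNIV
               (\<lambda>q r. Tp_dist p \<alpha> (solenoid_map p (Qp_of_rat p q)) (solenoid_map p (Qp_of_rat p r)))
               (carrier (Tp p)) (Tp_dist p \<alpha>) (\<lambda>q. solenoid_map p (Qp_of_rat p q)))"
proof -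
  interpret padic p using assms by unfold_locales
  have "range (Qp_of_rat p) \<subseteq> carrier (Qp p)" by auto
  thus ?thesis
    by (intro conjI allI impI solenoid_map_group_hom solenoid_map_inj solenoid_map_local_isometry
        solenoid_rat_closure Tp_complete solenoid_completion image_mono)
qed

end
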